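(* Let $q\in(0,1)$ and $\xi\in[0,1)$. Both the squared type $q$-Plancherel measure $\mu_{q\mathrm{PP}_S}[\,\cdot\,;\xi,q]$ and the mixed type $q$-Plancherel measure $\mu_{q\mathrm{PP}_M}[\,\cdot\,;\xi,q]$ are discrete determinantal point processes: for each of these measures there exists a function $K:\mathbb{Z}'\times\mathbb{Z}'\to\mathbb{C}$, $\mathbb{Z}'=\mathbb{Z}+\frac12$, such that for every $k\ge1$ and all pairwise distinct $z_1,\dots,z_k\in\mathbb{Z}'$, $$\mathbb{P}\big[\{z_1,\dots,z_k\}\subset\Xi(\lambda)\big]=\det_{1\le i,j\le k}K(z_i,z_j).$$
   Context: For a partition $\lambda$ let $\lambda^{\mathrm T}$ be its transpose, $|\lambda|=\sum_i\lambda_i$, $b(\lambda)=\sum_{i\ge1}(i-1)\lambda_i$, $h(i,j)=\lambda_i+\lambda_j^{\mathrm T}-i-j+1$ for $(i,j)\in\lambda$, and $\Xi(\lambda)=\{\lambda_i-i+\frac12\}_{i\ge1}\subset\mathbb{Z}'$ (with $\lambda_i=0$ beyond the length of $\lambda$). The two $q$-Plancherel measures are the probability measures on the set of all partitions $$\mu_{q\mathrm{PP}_S}[\lambda;\xi,q]=M(\xi;q)^{-1}(\xi^2q)^{|\lambda|}q^{2b(\lambda)}\prod_{(i,j)\in\lambda}\frac1{(1-q^{h(i,j)})^2},\qquad M(\xi;q)=\prod_{n\ge1}(1-\xi^2q^n)^{-n},$$ $$\mu_{q\mathrm{PP}_M}[\lambda;\xi,q]=\exp\Big(-\frac{\xi^2}{1-q}\Big)\,\xi^{2|\lambda|}q^{b(\lambda)}\prod_{(i,j)\in\lambda}\frac1{h(i,j)(1-q^{h(i,j)})}.$$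 *)

theory Defs
  imports "HOL-Probability.Probability" "Jordan_Normal_Form.Determinant"
begin

(* A partition is stored with indices shifted by one: p i is the part \<lambda>_{i+1}. *)
definition partitions :: "(nat \<Rightarrow> nat) set" where
  "partitions = {p. antimono p \<and> finite {i. p i \<noteq> 0}}"

definition part_size :: "(nat \<Rightarrow> nat) \<Rightarrow> nat" where
  "part_size p = (\<Sum>i | p i \<noteq> 0. p i)"

definition part_b :: "(nat \<Rightarrow> nat) \<Rightarrow> nat" where
  "part_b p = (\<Sum>i | p i \<noteq> 0. i * p i)"

definition transpose_part :: "(nat \<Rightarrow> nat) \<Rightarrow> (nat \<Rightarrow> nat)" where
  "transpose_part p j = card {i. j < p i}"

definition cells :: "(nat \<Rightarrow> nat) \<Rightarrow> (nat \<times> nat) set" where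
  "cells p = {(i, j). j < p i}"

(* The usual \<lambda>_i + \<lambda>^T_j - i - j + 1 with both indices shifted. For p in partitions and
   (i, j) in cells p we have j < p i and i < transpose_part p j, so the subtraction does not
   truncate and the value is positive. *)
definition hook :: "(nat \<Rightarrow> nat) \<Rightarrow> nat \<Rightarrow> nat \<Rightarrow> nat" where
  "hook p i j = p i + transpose_part p j - (i + 1) - (j + 1) + 1"

definition half_integers :: "real set" where
  "half_integers = range (\<lambda>n::int. of_int n + 1 / 2)"

definition Xi :: "(nat \<Rightarrow> nat) \<Rightarrow> real set" where
  "Xi p = range (\<lambda>i. real (p i) - real (i + 1) + 1 / 2)"

definition MacMahon :: "real \<Rightarrow> real \<Rightarrow> real" where
  "MacMahon \<xi> q = (\<Prod>n. 1 / (1 - \<xi>\<^sup>2 * q ^ (n + 1)) ^ (n + 1))"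

definition qPP_S_weight :: "real \<Rightarrow> real \<Rightarrow> (nat \<Rightarrow> nat) \<Rightarrow> real" where
  "qPP_S_weight \<xi> q p =
     1 / MacMahon \<xi> q * (\<xi>\<^sup>2 * q) ^ part_size p * q ^ (2 * part_b p) *
     (\<Prod>(i, j)\<in>cells p. 1 / (1 - q ^ hook p i j)\<^sup>2)"

definition qPP_M_weight :: "real \<Rightarrow> real \<Rightarrow> (nat \<Rightarrow> nat) \<Rightarrow> real" where
  "qPP_M_weight \<xi> q p =
     exp (- (\<xi>\<^sup>2 / (1 - q))) * \<xi> ^ (2 * part_size p) * q ^ part_b p *
     (\<Prod>(i, j)\<in>cells p. 1 / (real (hook p i j) * (1 - q ^ hook p i j)))"

definition qPP_S :: "real \<Rightarrow> real \<Rightarrow> (nat \<Rightarrow> nat) measure" where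
  "qPP_S \<xi> q = point_measure partitions (\<lambda>p. ennreal (qPP_S_weight \<xi> q p))"

definition qPP_M :: "real \<Rightarrow> real \<Rightarrow> (nat \<Rightarrow> nat) measure" where
  "qPP_M \<xi> q = point_measure partitions (\<lambda>p. ennreal (qPP_M_weight \<xi> q p))"

(* X is a random point configuration in the discrete set S. *)
definition discrete_point_process :: "'a measure \<Rightarrow> ('a \<Rightarrow> 'b set) \<Rightarrow> 'b set \<Rightarrow> bool" where
  "discrete_point_process M X S \<longleftrightarrow>
     prob_space M \<and>
     (\<forall>x\<in>space M. X x \<subseteq> S) \<and>
     (\<forall>s\<in>S. {x \<in> space M. s \<in> X x} \<in> sets M)"

definition determinantal ::
  "'a measure \<Rightarrow> ('a \<Rightarrow> 'b set) \<Rightarrow> 'b set \<Rightarrow> ('b \<Rightarrow> 'b \<Rightarrow> complex) \<Rightarrow> bool" where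
  "determinantal M X S K \<longleftrightarrow>
     (\<forall>k\<ge>1. \<forall>z :: nat \<Rightarrow> 'b. z ` {..<k} \<subseteq> S \<longrightarrow> inj_on z {..<k} \<longrightarrow>
        complex_of_real (measure M {x \<in> space M. z ` {..<k} \<subseteq> X x}) =
        Determinant.det (mat k k (\<lambda>(i, j). K (z i) (z j))))"

end

theory Submission
  imports Defs "HOL-Complex_Analysis.Great_Picard"
begin

text \<open>Both weights are, up to normalisation, products \<open>s\<^sub>\<lambda>(h\<^sub>1) s\<^sub>\<lambda>(h\<^sub>2)\<close> of two specialised Schur
  functions, written as Jacobi--Trudi determinants over the shifted parts of \<open>\<lambda>\<close>. Restricted to
  partitions inside an \<open>N \<times> N\<close> box they form a finite biorthogonal ensemble: by Cauchy--Binet and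
  Sylvester's identity its correlations are minors of a kernel \<open>K\<^sub>N\<close>. Row operations bring the
  defining matrices into the form \<open>(1 | A)\<close> with entries of \<open>A\<close> decaying geometrically and
  independently of \<open>N\<close> (these are hook Schur functions), so that the kernels are bounded uniformly in \<open>N\<close>. A
  diagonal subsequence of the \<open>K\<^sub>N\<close> then converges pointwise to a kernel of the full process. The
  total mass comes from the Cauchy identity with variables \<open>1, q, ..., q ^ (N - 1)\<close> on one side,
  letting \<open>N\<close> tend to infinity.\<close>

section \<open>Determinants\<close>

text \<open>The statement asks only that a kernel exists, so compactness can replace an explicit
  formula: a correlation involves finitely many kernel values, and determinants are continuous in
  them. The obstacle is a bound that does not degrade with \<open>N\<close>. The inverse of the Gram
  matrix is estimated by Cramer's rule, with cofactors bounded by products of row sums. For the raw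
  Toeplitz rows this would be too weak, because each of the \<open>N\<close> row sums can exceed 1
  by a fixed amount, and the product can grow exponentially. In reduced form the excess in row
  \<open>i\<close> is at most a constant times \<open>(N - i) * t ^ (N - 1 - i)\<close>, so only the
  rows with \<open>i\<close> close to \<open>N\<close> matter and the product stays bounded.
  Reduction multiplies by a unitriangular matrix and so leaves all maximal minors, hence the
  ensemble, unchanged. The Gram determinant is at least 1 because the empty partition has
  unnormalised weight 1 and no weight is negative.\<close>

definition ddet :: "nat \<Rightarrow> (nat \<Rightarrow> nat \<Rightarrow> real) \<Rightarrow> real" where
  "ddet N f = Determinant.det (Matrix.mat N N (\<lambda>(i, j). f i j))"

lemma ddet_Leibniz:
  "ddet N f = (\<Sum>p | p permutes {..<N}. of_int (sign p) * (\<Prod>i<N. f i (p i)))"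
  unfolding ddet_def
  by (subst det_def'[of _ N]) (auto intro!: sum.cong prod.cong simp: permutes_in_image atLeast0LessThan
      dest: permutes_in_image)

lemma ddet_cong:
  assumes "\<And>i j. i < N \<Longrightarrow> j < N \<Longrightarrow> f i j = g i j"
  shows "ddet N f = ddet N g"
proof -
  have "Matrix.mat N N (\<lambda>(i, j). f i j) = Matrix.mat N N (\<lambda>(i, j). g i j)"
    using assms by (intro eq_matI) auto
  then show ?thesis by (simp add: ddet_def)
qed

lemma ddet_transpose: "ddet N (\<lambda>i j. f j i) = ddet N f"
proof -
  have "Matrix.mat N N (\<lambda>(i, j). f j i) = transpose_mat (Matrix.mat N N (\<lambda>(i, j). f i j))"
    by (intro eq_matI) auto
  then show ?thesis by (simp add: ddet_def det_transpose[of _ N])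
qed

lemma ddet_mult: "ddet N (\<lambda>i j. \<Sum>k<N. f i k * g k j) = ddet N f * ddet N g"
proof -
  have "Matrix.mat N N (\<lambda>(i, j). \<Sum>k<N. f i k * g k j) =
        Matrix.mat N N (\<lambda>(i, j). f i j) * Matrix.mat N N (\<lambda>(i, j). g i j)"
    by (intro eq_matI) (auto simp: scalar_prod_def atLeast0LessThan)
  then show ?thesis by (simp add: ddet_def det_mult[of _ N])
qed

lemma ddet_permute_rows:
  assumes "p permutes {..<N}"
  shows "ddet N (\<lambda>i j. f (p i) j) = of_int (sign p) * ddet N f"
proof -
  have "Matrix.mat N N (\<lambda>(i, j). f (p i) j) =
        Matrix.mat N N (\<lambda>(i, j). Matrix.mat N N (\<lambda>(i, j). f i j) $$ (p i, j))"
    using permutes_in_image[OF assms] by (intro eq_matI) auto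
  then show ?thesis
    using assms by (simp add: ddet_def det_permute_rows[of _ N] atLeast0LessThan)
qed

lemma ddet_identical_rows:
  assumes "i < N" "j < N" "i \<noteq> j" "\<And>k. k < N \<Longrightarrow> f i k = f j k"
  shows "ddet N f = 0"
  unfolding ddet_def
  by (rule det_identical_rows[of _ N i j]) (use assms in \<open>auto simp: Matrix.row_def intro!: eq_vecI\<close>)

lemma ddet_scale_rows: "ddet N (\<lambda>i j. a i * f i j) = (\<Prod>i<N. a i) * ddet N f"
  by (simp add: ddet_Leibniz prod.distrib sum_distrib_left mult_ac)

lemma ddet_scale_cols: "ddet N (\<lambda>i j. a j * f i j) = (\<Prod>i<N. a i) * ddet N f"
  using ddet_scale_rows[of N a "\<lambda>i j. f j i"] ddet_transpose[of N "\<lambda>i j. a j * f i j"]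
    ddet_transpose[of N f] by simp

lemma ddet_upper_triangular:
  assumes "\<And>i j. j < i \<Longrightarrow> i < N \<Longrightarrow> f i j = 0"
  shows "ddet N f = (\<Prod>i<N. f i i)"
  unfolding ddet_def
  by (subst det_upper_triangular[of _ N])
     (use assms in \<open>auto simp: upper_triangular_def prod_list_diag_prod atLeast0LessThan\<close>)

lemma ddet_lower_triangular:
  assumes "\<And>i j. i < j \<Longrightarrow> j < N \<Longrightarrow> f i j = 0"
  shows "ddet N f = (\<Prod>i<N. f i i)"
  using ddet_upper_triangular[of N "\<lambda>i j. f j i"] ddet_transpose[of N f] assms by simp

lemma ddet_identity: "ddet N (\<lambda>i j. if i = j then 1 else 0) = 1"
  by (subst ddet_upper_triangular) auto

lemma tendsto_ddet [tendsto_intros]: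
  assumes "\<And>i j. i < N \<Longrightarrow> j < N \<Longrightarrow> ((\<lambda>x. f x i j) \<longlongrightarrow> g i j) F"
  shows "((\<lambda>x. ddet N (f x)) \<longlongrightarrow> ddet N g) F"
  unfolding ddet_Leibniz
  by (intro tendsto_intros assms) (auto dest: permutes_in_image)

lemma permutes_nat_less: "p permutes {..<N} \<Longrightarrow> x < N \<Longrightarrow> p x < (N::nat)"
  using permutes_in_image[of p "{..<N}" x] by simp

text \<open>Multiplying out the row sums gives one nonnegative term for every self-map of the index
  set; the Leibniz terms are those of the bijective ones.\<close>

lemma abs_ddet_le: "\<bar>ddet N f\<bar> \<le> (\<Prod>i<N. \<Sum>j<N. \<bar>f i j\<bar>)"
proof -
  \<comment> \<open>Permutations are total functions fixing everything outside
    \<open>{..<N}\<close>; restriction places them, without loss, in the extensional function space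
    that indexes the expanded product.\<close>
  have inj: "inj_on (\<lambda>p. restrict p {..<N}) {p. p permutes {..<N}}"
  proof (rule inj_onI)
    fix p p' assume p: "p \<in> {p. p permutes {..<N}}" "p' \<in> {p. p permutes {..<N}}"
      and eq: "restrict p {..<N} = restrict p' {..<N}"
    then have "p x = p' x" for x
      using p by (cases "x < N") (metis eq lessThan_iff restrict_apply', auto simp: permutes_not_in)
    then show "p = p'" by auto
  qed
  have "\<bar>ddet N f\<bar> \<le> (\<Sum>p | p permutes {..<N}. \<bar>of_int (sign p) * (\<Prod>i<N. f i (p i))\<bar>)"
    unfolding ddet_Leibniz by (rule sum_abs)
  also have "\<dots> = (\<Sum>p | p permutes {..<N}. \<Prod>i<N. \<bar>f i (restrict p {..<N} i)\<bar>)"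
    by (intro sum.cong refl) (auto simp: abs_mult abs_prod sign_def)
  also have "\<dots> = (\<Sum>h\<in>(\<lambda>p. restrict p {..<N}) ` {p. p permutes {..<N}}. \<Prod>i<N. \<bar>f i (h i)\<bar>)"
    by (simp add: sum.reindex[OF inj])
  also have "\<dots> \<le> (\<Sum>h\<in>{..<N} \<rightarrow>\<^sub>E {..<N}. \<Prod>i<N. \<bar>f i (h i)\<bar>)"
  proof (rule sum_mono2)
    show "(\<lambda>p. restrict p {..<N}) ` {p. p permutes {..<N}} \<subseteq> {..<N} \<rightarrow>\<^sub>E {..<N}"
      using permutes_nat_less by (intro image_subsetI) (simp add: restrict_PiE_iff)
  qed (auto intro!: finite_PiE prod_nonneg)
  also have "\<dots> = (\<Prod>i<N. \<Sum>j<N. \<bar>f i j\<bar>)"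
    by (simp add: prod_sum_PiE)
  finally show ?thesis .
qed

text \<open>The right inverse is the adjugate over the determinant. A cofactor is at most the
  product of the remaining row sums; \<open>r i\<close> being at least 1 lets the missing factor be
  put back, and dividing by a determinant of at least 1 does not increase the bound.\<close>

lemma bounded_right_inverse:
  assumes rows: "\<And>i. i < N \<Longrightarrow> (\<Sum>j<N. \<bar>f i j\<bar>) \<le> r i"
    and r: "\<And>i. i < N \<Longrightarrow> 1 \<le> r i"
    and det: "1 \<le> ddet N f"
  obtains e where "\<And>i j. i < N \<Longrightarrow> j < N \<Longrightarrow> (\<Sum>l<N. f i l * e l j) = (if i = j then 1 else 0)"
    "\<And>i j. i < N \<Longrightarrow> j < N \<Longrightarrow> \<bar>e i j\<bar> \<le> (\<Prod>i<N. r i)"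
proof -
  define A where "A = Matrix.mat N N (\<lambda>(i, j). f i j)"
  have A: "A \<in> carrier_mat N N" by (simp add: A_def)
  have dA: "Determinant.det A = ddet N f" by (simp add: A_def ddet_def)
  define e where "e i j = adj_mat A $$ (i, j) / ddet N f" for i j
  have "(\<Sum>l<N. f i l * e l j) = (if i = j then 1 else 0)" if "i < N" "j < N" for i j
  proof -
    have "(A * adj_mat A) $$ (i, j) = (\<Sum>l<N. f i l * adj_mat A $$ (l, j))"
      using that adj_mat(1)[OF A] by (simp add: A_def scalar_prod_def atLeast0LessThan)
    also have "(A * adj_mat A) $$ (i, j) = (if i = j then ddet N f else 0)"
      using that by (simp add: adj_mat(2)[OF A] dA)
    finally show ?thesis using det by (auto simp: e_def sum_divide_distrib[symmetric])
  qed
  moreover have "\<bar>e i j\<bar> \<le> (\<Prod>i<N. r i)" if ij: "i < N" "j < N" for i j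
  proof -
    \<comment> \<open>\<open>?s m\<close> enumerates the naturals that differ from \<open>m\<close>,
      as deleting row or column \<open>m\<close> does.\<close>
    let ?s = "\<lambda>m n. if n < m then n else Suc n"
    have "adj_mat A $$ (i, j) = cofactor A j i"
      using ij A by (simp add: adj_mat_def)
    also have "\<dots> = (-1) ^ (j + i) * ddet (N - 1) (\<lambda>a b. f (?s j a) (?s i b))"
    proof -
      have "mat_delete A j i = Matrix.mat (N - 1) (N - 1) (\<lambda>(a, b). f (?s j a) (?s i b))"
        unfolding mat_delete_def using ij by (intro eq_matI) (auto simp: A_def)
      then show ?thesis by (simp add: cofactor_def ddet_def)
    qed
    finally have "\<bar>adj_mat A $$ (i, j)\<bar> = \<bar>ddet (N - 1) (\<lambda>a b. f (?s j a) (?s i b))\<bar>"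
      by (simp add: abs_mult)
    also have "\<dots> \<le> (\<Prod>a<N - 1. \<Sum>b<N - 1. \<bar>f (?s j a) (?s i b)\<bar>)"
      by (rule abs_ddet_le)
    also have "\<dots> \<le> (\<Prod>a<N - 1. r (?s j a))"
    proof (intro prod_mono conjI sum_nonneg)
      fix a assume a: "a \<in> {..<N - 1}"
      have inj: "inj_on (?s i) {..<N - 1}" by (auto simp: inj_on_def split: if_splits)
      have "(\<Sum>b<N - 1. \<bar>f (?s j a) (?s i b)\<bar>) = (\<Sum>b\<in>?s i ` {..<N - 1}. \<bar>f (?s j a) b\<bar>)"
        by (subst sum.reindex[OF inj]) simp
      also have "\<dots> \<le> (\<Sum>b<N. \<bar>f (?s j a) b\<bar>)"
        by (intro sum_mono2) auto
      also have "\<dots> \<le> r (?s j a)" using a by (intro rows) auto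
      finally show "(\<Sum>b<N - 1. \<bar>f (?s j a) (?s i b)\<bar>) \<le> r (?s j a)" .
    qed auto
    also have "\<dots> \<le> (\<Prod>a<N. r a)"
    proof -
      have inj: "inj_on (?s j) {..<N - 1}" by (auto simp: inj_on_def split: if_splits)
      have "(\<Prod>a<N - 1. r (?s j a)) = (\<Prod>a\<in>?s j ` {..<N - 1}. r a)"
        by (subst prod.reindex[OF inj]) simp
      also have "\<dots> \<le> (\<Prod>a<N. r a)"
      proof (rule prod_mono2)
        show "0 \<le> r a" if "a \<in> ?s j ` {..<N - 1}" for a
          using that r[of a] by force
        show "1 \<le> r b" if "b \<in> {..<N} - ?s j ` {..<N - 1}" for b
          using that r by auto
      qed auto
      finally show ?thesis .
    qed
    finally have "\<bar>adj_mat A $$ (i, j)\<bar> \<le> (\<Prod>a<N. r a)" .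
    moreover have "\<bar>adj_mat A $$ (i, j)\<bar> / ddet N f \<le> \<bar>adj_mat A $$ (i, j)\<bar> / 1"
      using det by (intro divide_left_mono) auto
    ultimately show ?thesis
      using det by (simp add: e_def abs_divide)
  qed
  ultimately show ?thesis using that by blast
qed

text \<open>With the block matrices \<open>P = (1 A; B 1)\<close> and
  \<open>Q = (1 0; -B 1)\<close>, where \<open>Q\<close> has determinant 1, both
  \<open>P * Q\<close> and \<open>Q * P\<close> are block upper triangular; their nontrivial
  diagonal blocks are \<open>1 - A B\<close> and \<open>1 - B A\<close>.\<close>

lemma ddet_Sylvester:
  "ddet N (\<lambda>i j. (if i = j then 1 else 0) - (\<Sum>a<k. A i a * B a j)) =
   ddet k (\<lambda>a b. (if a = b then 1 else 0) - (\<Sum>i<N. B a i * A i b))"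
proof -
  define MA where "MA = Matrix.mat N k (\<lambda>(i, a). A i a)"
  define MB where "MB = Matrix.mat k N (\<lambda>(a, i). B a i)"
  have c [simp]: "MA \<in> carrier_mat N k" "MB \<in> carrier_mat k N" by (auto simp: MA_def MB_def)
  let ?P = "four_block_mat (1\<^sub>m N) MA MB (1\<^sub>m k)"
  let ?Q = "four_block_mat (1\<^sub>m N) (0\<^sub>m N k) (- MB) (1\<^sub>m k)"
  have dQ: "Determinant.det ?Q = 1"
    by (subst det_four_block_mat_upper_right_zero[of _ N _ k]) auto
  have "MA * MB \<in> carrier_mat N N" "MB * MA \<in> carrier_mat k k"
    using c by (metis mult_carrier_mat)+
  then have c' [simp]: "1\<^sub>m N - MA * MB \<in> carrier_mat N N" "1\<^sub>m k - MB * MA \<in> carrier_mat k k"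
    by (auto intro!: minus_carrier_mat)
  have P: "?P \<in> carrier_mat (N + k) (N + k)" and Q: "?Q \<in> carrier_mat (N + k) (N + k)" by auto
  have "?P * ?Q = four_block_mat (1\<^sub>m N - MA * MB) MA (0\<^sub>m k N) (1\<^sub>m k)"
    by (subst mult_four_block_mat[of _ N N _ k _ k _ _ N _ k]) 
       (auto intro!: cong_four_block_mat eq_matI simp: scalar_prod_def MA_def MB_def sum_negf)
  then have "Determinant.det ?P * Determinant.det ?Q = Determinant.det (1\<^sub>m N - MA * MB)"
    using det_mult[OF P Q] det_four_block_mat_lower_left_zero[OF c'(1) c(1) refl one_carrier_mat] by simp
  moreover have "?Q * ?P = four_block_mat (1\<^sub>m N) MA (0\<^sub>m k N) (1\<^sub>m k - MB * MA)"
    by (subst mult_four_block_mat[of _ N N _ k _ k _ _ N _ k]) 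
       (auto intro!: cong_four_block_mat eq_matI simp: scalar_prod_def MA_def MB_def sum_negf)
  then have "Determinant.det ?Q * Determinant.det ?P = Determinant.det (1\<^sub>m k - MB * MA)"
    using det_mult[OF Q P] det_four_block_mat_lower_left_zero[OF one_carrier_mat c(1) refl c'(2)] by simp
  moreover have "1\<^sub>m N - MA * MB = Matrix.mat N N (\<lambda>(i, j). (if i = j then 1 else 0) - (\<Sum>a<k. A i a * B a j))"
    by (intro eq_matI) (auto simp: MA_def MB_def scalar_prod_def atLeast0LessThan)
  moreover have "1\<^sub>m k - MB * MA = Matrix.mat k k (\<lambda>(a, b). (if a = b then 1 else 0) - (\<Sum>i<N. B a i * A i b))"
    by (intro eq_matI) (auto simp: MA_def MB_def scalar_prod_def atLeast0LessThan)
  ultimately show ?thesis by (simp add: ddet_def dQ)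
qed

section \<open>Increasing enumerations of subsets and the Cauchy-Binet formula\<close>

definition incr :: "nat \<Rightarrow> nat set \<Rightarrow> (nat \<Rightarrow> nat) set" where
  "incr N U = {g \<in> {..<N} \<rightarrow>\<^sub>E U. strict_mono_on {..<N} g}"

lemma finite_incr [simp]: "finite U \<Longrightarrow> finite (incr N U)"
  by (auto simp: incr_def intro!: finite_PiE)

text \<open>Sorting recovers an increasing map from its image. So the extensional increasing maps
  stand for the \<open>N\<close>-element subsets of \<open>U\<close> and at the same time fix the
  order of the rows in the minors.\<close>

lemma incr_ext:
  assumes "g \<in> incr N U" "g' \<in> incr N U" "g ` {..<N} = g' ` {..<N}"
  shows "g = g'"
proof -
  have *: "map g [0..<N] = sorted_list_of_set (g ` {..<N})" if "g \<in> incr N U" for g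
  proof (rule sorted_distinct_set_unique)
    have sm: "g i < g j" if "i < j" "j < N" for i j
      using \<open>g \<in> incr N U\<close> that unfolding incr_def strict_mono_on_def by auto
    show "sorted (map g [0..<N])"
      unfolding sorted_iff_nth_mono_less using sm by (auto intro: less_imp_le)
    show "distinct (map g [0..<N])"
      using sm by (auto simp: distinct_map inj_on_def) (metis less_irrefl nat_neq_iff)
  qed (auto simp: lessThan_atLeast0)
  have "map g [0..<N] = map g' [0..<N]"
    using *[OF assms(1)] *[OF assms(2)] assms(3) by simp
  then have "g i = g' i" if "i < N" for i
    using that by (metis add.left_neutral diff_zero length_upt nth_map nth_upt)
  then show ?thesis
    using assms(1,2) PiE_ext[of g "{..<N}" "\<lambda>_. U" g'] by (simp add: incr_def)
qed

lemma incr_enumeration: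
  assumes "finite S" "card S = N" "S \<subseteq> U"
  obtains g where "g \<in> incr N U" "g ` {..<N} = S"
proof -
  define L where "L = sorted_list_of_set S"
  have L: "length L = N" "set L = S" "sorted_wrt (<) L"
    using assms by (auto simp: L_def)
  define g where "g = restrict (\<lambda>i. L ! i) {..<N}"
  have im: "g ` {..<N} = S"
    using L(1,2) by (auto simp: g_def image_def in_set_conv_nth)
  moreover have "strict_mono_on {..<N} g"
    using L(1,3) by (auto simp: g_def strict_mono_on_def sorted_wrt_iff_nth_less)
  ultimately have "g \<in> incr N U"
    using assms(3) unfolding incr_def by (auto simp: g_def)
  with im that show ?thesis by blast
qed

lemma incr_inj: "g \<in> incr N U \<Longrightarrow> inj_on g {..<N}"
  unfolding incr_def by (auto intro: strict_mono_on_imp_inj_on)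

text \<open>Every injective map is the increasing enumeration of its image precomposed with a unique
  permutation. This is the regrouping behind Cauchy-Binet.\<close>

lemma bij_betw_incr_permutes:
  assumes "finite U"
  shows "bij_betw (\<lambda>(g, p). restrict (g \<circ> p) {..<N}) (incr N U \<times> {p. p permutes {..<N}})
           {f \<in> {..<N} \<rightarrow>\<^sub>E U. inj_on f {..<N}}"
proof (rule bij_betw_imageI)
  have im: "restrict (g \<circ> p) {..<N} ` {..<N} = g ` {..<N}" if "p permutes {..<N}" for g p :: "nat \<Rightarrow> nat"
    using permutes_image[OF that] by (metis image_comp image_restrict_eq)
  show "inj_on (\<lambda>(g, p). restrict (g \<circ> p) {..<N}) (incr N U \<times> {p. p permutes {..<N}})"
  proof (rule inj_onI, clarify)
    fix g p g' p'
    assume g: "g \<in> incr N U" "g' \<in> incr N U" and p: "p permutes {..<N}" "p' permutes {..<N}"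
      and eq: "restrict (g \<circ> p) {..<N} = restrict (g' \<circ> p') {..<N}"
    have "g ` {..<N} = g' ` {..<N}" using im[OF p(1), of g] im[OF p(2), of g'] eq by simp
    then have gg: "g = g'" by (rule incr_ext[OF g])
    have "p x = p' x" for x
    proof (cases "x < N")
      case True
      then have "g (p x) = g (p' x)" using fun_cong[OF eq, of x] gg by simp
      then show ?thesis
        using incr_inj[OF g(1)] True permutes_in_image[OF p(1), of x] permutes_in_image[OF p(2), of x]
        by (auto simp: inj_on_def)
    qed (use p in \<open>simp add: permutes_not_in\<close>)
    with gg show "g = g' \<and> p = p'" by auto
  qed
  show "(\<lambda>(g, p). restrict (g \<circ> p) {..<N}) ` (incr N U \<times> {p. p permutes {..<N}}) =
        {f \<in> {..<N} \<rightarrow>\<^sub>E U. inj_on f {..<N}}"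
  proof (intro equalityI subsetI)
    fix f assume "f \<in> (\<lambda>(g, p). restrict (g \<circ> p) {..<N}) ` (incr N U \<times> {p. p permutes {..<N}})"
    then obtain g p where gp: "g \<in> incr N U" "p permutes {..<N}" and f: "f = restrict (g \<circ> p) {..<N}"
      by auto
    have "inj_on (g \<circ> p) {..<N}"
      using gp incr_inj[OF gp(1)] by (intro comp_inj_on) (auto simp: permutes_image permutes_inj_on)
    moreover have "(g \<circ> p) i \<in> U" if "i < N" for i
      using gp permutes_in_image[OF gp(2), of i] that by (auto simp: incr_def)
    ultimately show "f \<in> {f \<in> {..<N} \<rightarrow>\<^sub>E U. inj_on f {..<N}}"
      by (auto simp: f inj_on_restrict_eq)
  next
    fix f assume f: "f \<in> {f \<in> {..<N} \<rightarrow>\<^sub>E U. inj_on f {..<N}}"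
    then have "card (f ` {..<N}) = N" "f ` {..<N} \<subseteq> U" by (auto simp: card_image)
    then obtain g where g: "g \<in> incr N U" "g ` {..<N} = f ` {..<N}"
      using incr_enumeration[of "f ` {..<N}" N U] by auto
    have bg: "bij_betw g {..<N} (f ` {..<N})" using g incr_inj[OF g(1)] by (auto simp: bij_betw_def)
    define p where "p = (\<lambda>i. if i < N then inv_into {..<N} g (f i) else i)"
    have "bij_betw (inv_into {..<N} g \<circ> f) {..<N} {..<N}"
      using f bij_betw_trans[of f "{..<N}" "f ` {..<N}" "inv_into {..<N} g" "{..<N}"]
        bij_betw_inv_into[OF bg] by (auto simp: bij_betw_def)
    then have "bij_betw p {..<N} {..<N}"
      by (rule iffD1[OF bij_betw_cong, rotated]) (auto simp: p_def)
    then have "p permutes {..<N}" by (rule bij_imp_permutes) (auto simp: p_def)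
    moreover have "f = restrict (g \<circ> p) {..<N}"
    proof (rule PiE_ext[of f "{..<N}" "\<lambda>_. U"])
      show "f \<in> {..<N} \<rightarrow>\<^sub>E U" using f by simp
      show eq: "f x = restrict (g \<circ> p) {..<N} x" if "x \<in> {..<N}" for x
        using that g(2) by (auto simp: p_def f_inv_into_f)
      show "restrict (g \<circ> p) {..<N} \<in> {..<N} \<rightarrow>\<^sub>E U"
        using eq f by (simp add: PiE_iff)
    qed
    ultimately show "f \<in> (\<lambda>(g, p). restrict (g \<circ> p) {..<N}) ` (incr N U \<times> {p. p permutes {..<N}})"
      using g(1) by (auto simp: image_iff)
  qed
qed

text \<open>Expanding leaves a choice of a point \<open>f i\<close> for each row. A choice with a
  repetition gives a determinant with two equal rows; the others are grouped by image, and the sign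
  from sorting the rows of the second determinant turns the bare products into the first
  one.\<close>

theorem Cauchy_Binet:
  assumes "finite U"
  shows "ddet N (\<lambda>i j. \<Sum>x\<in>U. \<phi> i x * \<psi> j x) =
    (\<Sum>g\<in>incr N U. ddet N (\<lambda>i k. \<phi> k (g i)) * ddet N (\<lambda>i k. \<psi> k (g i)))"
proof -
  let ?D = "\<lambda>f. ddet N (\<lambda>i j. \<psi> j (f i))"
  let ?P = "{p. p permutes {..<N}}"
  have "ddet N (\<lambda>i j. \<Sum>x\<in>U. \<phi> i x * \<psi> j x) =
    (\<Sum>p\<in>?P. of_int (sign p) * (\<Sum>f\<in>{..<N} \<rightarrow>\<^sub>E U. \<Prod>i<N. \<phi> i (f i) * \<psi> (p i) (f i)))"
    using assms by (simp add: ddet_Leibniz prod_sum_PiE)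
  also have "\<dots> = (\<Sum>f\<in>{..<N} \<rightarrow>\<^sub>E U. \<Sum>p\<in>?P. of_int (sign p) * (\<Prod>i<N. \<phi> i (f i) * \<psi> (p i) (f i)))"
    by (subst sum.swap) (simp add: sum_distrib_left)
  also have "\<dots> = (\<Sum>f\<in>{..<N} \<rightarrow>\<^sub>E U. (\<Prod>i<N. \<phi> i (f i)) * ?D f)"
    by (simp add: ddet_Leibniz prod.distrib sum_distrib_left mult_ac)
  also have "\<dots> = (\<Sum>f\<in>{f \<in> {..<N} \<rightarrow>\<^sub>E U. inj_on f {..<N}}. (\<Prod>i<N. \<phi> i (f i)) * ?D f)"
  proof (rule sum.mono_neutral_right)
    show "\<forall>f\<in>({..<N} \<rightarrow>\<^sub>E U) - {f \<in> {..<N} \<rightarrow>\<^sub>E U. inj_on f {..<N}}. (\<Prod>i<N. \<phi> i (f i)) * ?D f = 0"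
    proof
      fix f assume "f \<in> ({..<N} \<rightarrow>\<^sub>E U) - {f \<in> {..<N} \<rightarrow>\<^sub>E U. inj_on f {..<N}}"
      then obtain i j where "i < N" "j < N" "i \<noteq> j" "f i = f j" by (auto simp: inj_on_def)
      then have "?D f = 0" by (intro ddet_identical_rows[of i N j]) auto
      then show "(\<Prod>i<N. \<phi> i (f i)) * ?D f = 0" by simp
    qed
  qed (use assms in \<open>auto intro!: finite_PiE\<close>)
  also have "\<dots> = (\<Sum>(g, p)\<in>incr N U \<times> ?P. (\<Prod>i<N. \<phi> i (g (p i))) * ?D (g \<circ> p))"
    by (subst sum.reindex_bij_betw[OF bij_betw_incr_permutes[OF assms], symmetric])
       (auto intro!: sum.cong arg_cong2[of _ _ _ _ "(*)"] prod.cong ddet_cong)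
  also have "\<dots> = (\<Sum>g\<in>incr N U. \<Sum>p\<in>?P. (\<Prod>i<N. \<phi> i (g (p i))) * ?D (g \<circ> p))"
    by (simp add: sum.cartesian_product)
  also have "\<dots> = (\<Sum>g\<in>incr N U. ddet N (\<lambda>i j. \<phi> i (g j)) * ?D g)"
  proof (intro sum.cong refl)
    fix g
    have "(\<Sum>p\<in>?P. (\<Prod>i<N. \<phi> i (g (p i))) * ?D (g \<circ> p)) =
          (\<Sum>p\<in>?P. of_int (sign p) * (\<Prod>i<N. \<phi> i (g (p i))) * ?D g)"
      by (intro sum.cong refl) (auto simp: ddet_permute_rows[of _ _ "\<lambda>i j. \<psi> j (g i)"])
    also have "\<dots> = ddet N (\<lambda>i j. \<phi> i (g j)) * ?D g"
      by (simp add: ddet_Leibniz sum_distrib_right)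
    finally show "(\<Sum>p\<in>?P. (\<Prod>i<N. \<phi> i (g (p i))) * ?D (g \<circ> p)) = ddet N (\<lambda>i j. \<phi> i (g j)) * ?D g" .
  qed
  also have "\<dots> = (\<Sum>g\<in>incr N U. ddet N (\<lambda>i k. \<phi> k (g i)) * ?D g)"
    using ddet_transpose[of N "\<lambda>i j. \<phi> i (g j)" for g] by simp
  finally show ?thesis .
qed

section \<open>Inclusion-exclusion and the correlations of a biorthogonal ensemble\<close>

lemma ddet_identity_minus:
  "ddet k (\<lambda>a b. (if a = b then 1 else 0) - M a b) =
   (\<Sum>Y\<in>Pow {..<k}. (-1) ^ card Y * ddet k (\<lambda>a b. if a \<in> Y then M a b else if a = b then 1 else 0))"
proof -
  have "(\<Prod>i<k. (if i = p i then 1 else 0) - M i (p i)) =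
     (\<Sum>Y\<in>Pow {..<k}. (-1) ^ card Y * (\<Prod>i<k. if i \<in> Y then M i (p i) else if i = p i then 1 else 0))"
    for p :: "nat \<Rightarrow> nat"
  proof -
    have "(\<Prod>i<k. (if i = p i then 1 else 0) - M i (p i)) =
      (\<Prod>i<k. - M i (p i) + (if i = p i then 1 else 0))" by (simp add: algebra_simps)
    \<comment> \<open>\<open>Y\<close> is the set of rows taken from \<open>M\<close>. The other
      rows stay rows of the identity, so every minor keeps size \<open>k\<close> and no reindexing
      arises.\<close>
    also have "\<dots> = (\<Sum>Y\<in>Pow {..<k}. (\<Prod>i\<in>Y. - M i (p i)) * (\<Prod>i\<in>{..<k} - Y. if i = p i then 1 else 0))"
      by (rule prod_add) simp
    also have "\<dots> = (\<Sum>Y\<in>Pow {..<k}. (-1) ^ card Y * (\<Prod>i<k. if i \<in> Y then M i (p i) else if i = p i then 1 else 0))"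
    proof (intro sum.cong refl)
      fix Y assume Y: "Y \<in> Pow {..<k}"
      then have fin: "finite Y" by (auto intro: finite_subset)
      have "(\<Prod>i<k. if i \<in> Y then M i (p i) else if i = p i then 1 else 0) =
        (\<Prod>i\<in>{..<k} - Y. if i \<in> Y then M i (p i) else if i = p i then 1 else 0) *
        (\<Prod>i\<in>Y. if i \<in> Y then M i (p i) else if i = p i then 1 else 0)"
        using Y by (intro prod.subset_diff) auto
      also have "\<dots> = (\<Prod>i\<in>{..<k} - Y. if i = p i then 1 else 0) * (\<Prod>i\<in>Y. M i (p i))"
        by (intro arg_cong2[of _ _ _ _ "(*)"] prod.cong) auto
      moreover have "(\<Prod>i\<in>Y. - M i (p i)) = (-1) ^ card Y * (\<Prod>i\<in>Y. M i (p i))"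
        using prod.distrib[of "\<lambda>_. -1" "\<lambda>i. M i (p i)" Y] by simp
      ultimately show "(\<Prod>i\<in>Y. - M i (p i)) * (\<Prod>i\<in>{..<k} - Y. if i = p i then 1 else 0) =
         (-1) ^ card Y * (\<Prod>i<k. if i \<in> Y then M i (p i) else if i = p i then 1 else 0)"
        by simp
    qed
    finally show ?thesis .
  qed
  then show ?thesis
    unfolding ddet_Leibniz sum_distrib_left by (subst sum.swap) (simp add: sum_distrib_left mult_ac)
qed

text \<open>The expansion of a product of factors \<open>1 - [not P a]\<close>. Its signs and index
  set agree with those of \<open>ddet_identity_minus\<close>, so the two expansions can be matched
  term by term.\<close>

lemma indicator_subset_expand:
  "(\<Sum>Y\<in>Pow {..<k::nat}. (-1) ^ card Y * (if \<forall>a\<in>Y. \<not> P a then 1 else 0 :: real)) =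
   (if \<forall>a<k. P a then 1 else 0)"
proof -
  have eq: "(if \<forall>a\<in>Y. \<not> P a then 1 else 0 :: real) = (\<Prod>a\<in>Y. if P a then 0 else 1)" if "Y \<subseteq> {..<k}" for Y
    using finite_subset[OF that] by (induction rule: finite_induct) auto
  have eq2: "(\<Prod>a<k. if P a then 1 else 0 :: real) = (if \<forall>a<k. P a then 1 else 0)"
    by (cases "\<forall>a<k. P a") (auto intro!: prod_zero)
  have "(\<Prod>a<k. if P a then 1 else 0 :: real) = (\<Prod>a<k. - (if P a then 0 else 1) + 1)"
    by (intro prod.cong) auto
  also have "\<dots> = (\<Sum>Y\<in>Pow {..<k}. (\<Prod>a\<in>Y. - (if P a then 0 else 1)) * (\<Prod>a\<in>{..<k} - Y. 1))"
    by (rule prod_add) simp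
  also have "\<dots> = (\<Sum>Y\<in>Pow {..<k}. (-1) ^ card Y * (if \<forall>a\<in>Y. \<not> P a then 1 else 0))"
  proof (intro sum.cong refl)
    fix Y assume "Y \<in> Pow {..<k}"
    moreover have "(\<Prod>a\<in>Y. - (if P a then 0 else 1 :: real)) = (-1) ^ card Y * (\<Prod>a\<in>Y. if P a then 0 else 1)"
      using prod.distrib[of "\<lambda>_. -1 :: real" "\<lambda>a. if P a then 0 else 1" Y] by simp
    ultimately show "(\<Prod>a\<in>Y. - (if P a then 0 else 1 :: real)) * (\<Prod>a\<in>{..<k} - Y. 1) =
      (-1) ^ card Y * (if \<forall>a\<in>Y. \<not> P a then 1 else 0)" by (simp add: eq)
  qed
  finally show ?thesis by (simp add: eq2)
qed

text \<open>By Sylvester's identity the gap sums of the ensemble are minors of the identity minus the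
  kernel; inclusion--exclusion turns them into correlation sums.\<close>

theorem biorthogonal_correlation:
  assumes U: "finite U" and z: "z ` {..<k} \<subseteq> U" "inj_on z {..<k}"
    and inv: "\<And>i j. i < N \<Longrightarrow> j < N \<Longrightarrow>
      (\<Sum>l<N. (\<Sum>x\<in>U. \<phi> i x * \<psi> l x) * e l j) = (if i = j then 1 else 0)"
    and K: "\<And>x y. K x y = (\<Sum>j<N. \<psi> j x * (\<Sum>m<N. e j m * \<phi> m y))"
  shows "(\<Sum>g | g \<in> incr N U \<and> z ` {..<k} \<subseteq> g ` {..<N}.
            ddet N (\<lambda>i k. \<phi> k (g i)) * ddet N (\<lambda>i k. \<psi> k (g i))) =
         ddet N (\<lambda>i j. \<Sum>x\<in>U. \<phi> i x * \<psi> j x) * ddet k (\<lambda>a b. K (z a) (z b))"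
proof -
  let ?w = "\<lambda>g. ddet N (\<lambda>i k. \<phi> k (g i)) * ddet N (\<lambda>i k. \<psi> k (g i))"
  define G where "G i j = (\<Sum>x\<in>U. \<phi> i x * \<psi> j x)" for i j
  define M where "M a b = (if a = b then 1 else 0) - K (z a) (z b)" for a b
  have gap: "(\<Sum>g\<in>incr N U. (if \<forall>a\<in>Y. \<not> z a \<in> g ` {..<N} then 1 else 0) * ?w g) =
      ddet N G * ddet k (\<lambda>a b. if a \<in> Y then M a b else if a = b then 1 else 0)"
    if Y: "Y \<in> Pow {..<k}" for Y
  proof -
    have injY: "inj_on z Y" using Y z(2) by (auto intro: inj_on_subset)
    have sub: "incr N (U - z ` Y) = {g \<in> incr N U. \<forall>a\<in>Y. \<not> z a \<in> g ` {..<N}}"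
    proof (intro equalityI subsetI)
      fix g assume "g \<in> incr N (U - z ` Y)"
      then have g: "\<And>i. i < N \<Longrightarrow> g i \<in> U - z ` Y" "g \<in> extensional {..<N}" "strict_mono_on {..<N} g"
        by (auto simp: incr_def PiE_iff)
      have "z a \<notin> g ` {..<N}" if "a \<in> Y" for a
        using g(1) that by (metis DiffD2 imageE imageI lessThan_iff)
      then show "g \<in> {g \<in> incr N U. \<forall>a\<in>Y. \<not> z a \<in> g ` {..<N}}"
        using g by (auto simp: incr_def PiE_iff)
    next
      fix g assume "g \<in> {g \<in> incr N U. \<forall>a\<in>Y. \<not> z a \<in> g ` {..<N}}"
      then have g: "\<And>i. i < N \<Longrightarrow> g i \<in> U" "g \<in> extensional {..<N}" "strict_mono_on {..<N} g"
        and av: "\<And>a. a \<in> Y \<Longrightarrow> z a \<notin> g ` {..<N}"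
        by (auto simp: incr_def PiE_iff)
      have "g i \<notin> z ` Y" if "i < N" for i
        using av that by (metis imageE imageI lessThan_iff)
      then show "g \<in> incr N (U - z ` Y)"
        using g by (auto simp: incr_def PiE_iff)
    qed
    have "(\<Sum>g\<in>incr N U. (if \<forall>a\<in>Y. \<not> z a \<in> g ` {..<N} then 1 else 0) * ?w g) =
      (\<Sum>g\<in>incr N (U - z ` Y). ?w g)"
      unfolding sub using U by (intro sum.mono_neutral_cong_right) auto
    \<comment> \<open>Since \<open>e\<close> is a right inverse of \<open>G\<close>, the Gram matrix
      of the smaller ground set is \<open>G\<close> times the identity minus a product that factors
      through \<open>k\<close> dimensions. Sylvester's identity then trades size \<open>N\<close>
      for size \<open>k\<close>; the zeros for \<open>a\<close> outside \<open>Y\<close> keep that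
      size fixed.\<close>
    also have "\<dots> = ddet N (\<lambda>i j. \<Sum>x\<in>U - z ` Y. \<phi> i x * \<psi> j x)"
      by (rule Cauchy_Binet[symmetric]) (use U in auto)
    also have "\<dots> = ddet N (\<lambda>i j. \<Sum>l<N. G i l * ((if l = j then 1 else 0) -
        (\<Sum>a<k. (\<Sum>m<N. e l m * \<phi> m (z a)) * (if a \<in> Y then \<psi> j (z a) else 0))))"
    proof (rule ddet_cong)
      fix i j assume ij: "i < N" "j < N"
      have "(\<Sum>l<N. G i l * (\<Sum>a<k. (\<Sum>m<N. e l m * \<phi> m (z a)) * (if a \<in> Y then \<psi> j (z a) else 0))) =
        (\<Sum>a<k. (\<Sum>m<N. (\<Sum>l<N. G i l * e l m) * \<phi> m (z a)) * (if a \<in> Y then \<psi> j (z a) else 0))"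
      proof -
        have *: "(\<Sum>m<N. (\<Sum>l<N. G i l * e l m) * \<phi> m x) = (\<Sum>l<N. G i l * (\<Sum>m<N. e l m * \<phi> m x))" for x
          unfolding sum_distrib_left sum_distrib_right by (subst sum.swap) (simp only: mult.assoc)
        have "(\<Sum>l<N. G i l * (\<Sum>a<k. (\<Sum>m<N. e l m * \<phi> m (z a)) * (if a \<in> Y then \<psi> j (z a) else 0))) =
          (\<Sum>l<N. \<Sum>a<k. G i l * (\<Sum>m<N. e l m * \<phi> m (z a)) * (if a \<in> Y then \<psi> j (z a) else 0))"
          by (rule sum.cong[OF refl], subst sum_distrib_left, simp only: mult.assoc)
        also have "\<dots> = (\<Sum>a<k. (\<Sum>l<N. G i l * (\<Sum>m<N. e l m * \<phi> m (z a))) * (if a \<in> Y then \<psi> j (z a) else 0))"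
          by (subst sum.swap) (simp only: sum_distrib_right)
        finally show ?thesis by (simp only: *)
      qed
      also have "\<dots> = (\<Sum>a<k. \<phi> i (z a) * (if a \<in> Y then \<psi> j (z a) else 0))"
        using ij inv by (intro sum.cong refl arg_cong2[of _ _ _ _ "(*)"]) (simp add: G_def if_distrib[of "\<lambda>x. x * _"] cong: if_cong)
      also have "\<dots> = (\<Sum>a\<in>Y. \<phi> i (z a) * \<psi> j (z a))"
        using Y by (intro sum.mono_neutral_cong_right) auto
      also have "\<dots> = (\<Sum>x\<in>z ` Y. \<phi> i x * \<psi> j x)"
        by (simp add: sum.reindex[OF injY])
      finally have 1: "(\<Sum>l<N. G i l * (\<Sum>a<k. (\<Sum>m<N. e l m * \<phi> m (z a)) * (if a \<in> Y then \<psi> j (z a) else 0)))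
        = (\<Sum>x\<in>z ` Y. \<phi> i x * \<psi> j x)" .
      have 2: "(\<Sum>x\<in>U - z ` Y. \<phi> i x * \<psi> j x) = G i j - (\<Sum>x\<in>z ` Y. \<phi> i x * \<psi> j x)"
        unfolding G_def using U Y z by (intro sum_diff) auto
      have 3: "(\<Sum>l<N. G i l * (if l = j then 1 else 0)) = G i j"
        using ij by (simp add: if_distrib[of "\<lambda>x. _ * x"] cong: if_cong)
      show "(\<Sum>x\<in>U - z ` Y. \<phi> i x * \<psi> j x) = (\<Sum>l<N. G i l * ((if l = j then 1 else 0) -
        (\<Sum>a<k. (\<Sum>m<N. e l m * \<phi> m (z a)) * (if a \<in> Y then \<psi> j (z a) else 0))))"
        unfolding 2 right_diff_distrib sum_subtractf 1 3 ..
    qed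
    also have "\<dots> = ddet N G * ddet k (\<lambda>a b. (if a = b then 1 else 0) -
        (\<Sum>j<N. (if a \<in> Y then \<psi> j (z a) else 0) * (\<Sum>m<N. e j m * \<phi> m (z b))))"
      by (simp add: ddet_mult ddet_Sylvester)
    also have "ddet k (\<lambda>a b. (if a = b then 1 else 0) -
        (\<Sum>j<N. (if a \<in> Y then \<psi> j (z a) else 0) * (\<Sum>m<N. e j m * \<phi> m (z b)))) =
        ddet k (\<lambda>a b. if a \<in> Y then M a b else if a = b then 1 else 0)"
      by (intro ddet_cong) (auto simp: M_def K)
    finally show ?thesis .
  qed
  have "(\<Sum>g | g \<in> incr N U \<and> z ` {..<k} \<subseteq> g ` {..<N}. ?w g) =
    (\<Sum>g\<in>incr N U. (if \<forall>a<k. z a \<in> g ` {..<N} then 1 else 0) * ?w g)"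
    using U by (intro sum.mono_neutral_cong_left) auto
  also have "\<dots> = (\<Sum>g\<in>incr N U. \<Sum>Y\<in>Pow {..<k}. (-1) ^ card Y *
      ((if \<forall>a\<in>Y. \<not> z a \<in> g ` {..<N} then 1 else 0) * ?w g))"
    by (subst indicator_subset_expand[symmetric]) (simp add: sum_distrib_right mult.assoc)
  also have "\<dots> = (\<Sum>Y\<in>Pow {..<k}. (-1) ^ card Y *
      (\<Sum>g\<in>incr N U. (if \<forall>a\<in>Y. \<not> z a \<in> g ` {..<N} then 1 else 0) * ?w g))"
    by (subst sum.swap) (simp add: sum_distrib_left)
  also have "\<dots> = (\<Sum>Y\<in>Pow {..<k}. (-1) ^ card Y *
      (ddet N G * ddet k (\<lambda>a b. if a \<in> Y then M a b else if a = b then 1 else 0)))"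
    using gap by simp
  also have "\<dots> = ddet N G * ddet k (\<lambda>a b. (if a = b then 1 else 0) - M a b)"
    by (simp add: ddet_identity_minus sum_distrib_left mult_ac)
  also have "\<dots> = ddet N G * ddet k (\<lambda>a b. K (z a) (z b))"
    by (simp add: M_def)
  finally show ?thesis by (simp add: G_def[abs_def])
qed

section \<open>Partitions, shifted parts and hook lengths\<close>

definition part_box :: "nat \<Rightarrow> nat \<Rightarrow> (nat \<Rightarrow> nat) set" where
  "part_box N M = {p \<in> partitions. (\<forall>i. p i \<le> M) \<and> (\<forall>i\<ge>N. p i = 0)}"

text \<open>The increasing enumeration of the shifted parts \<open>\<lambda>\<^sub>i + N - i\<close>, \<open>1 \<le> i \<le> N\<close>.\<close>

definition beta :: "nat \<Rightarrow> (nat \<Rightarrow> nat) \<Rightarrow> nat \<Rightarrow> nat" where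
  "beta N p = restrict (\<lambda>i. p (N - 1 - i) + i) {..<N}"

lemma beta_apply: "i < N \<Longrightarrow> beta N p i = p (N - 1 - i) + i"
  by (simp add: beta_def)

lemma partitions_antimono: "p \<in> partitions \<Longrightarrow> i \<le> j \<Longrightarrow> p j \<le> p i"
  by (auto simp: partitions_def antimono_def)

lemma beta_less:
  assumes "p \<in> partitions" "j < i" "i < N"
  shows "beta N p j < beta N p i"
proof -
  have "p (N - 1 - j) \<le> p (N - 1 - i)" by (rule partitions_antimono[OF assms(1)]) (use assms in auto)
  then show ?thesis
    using assms beta_apply[of i N p] beta_apply[of j N p] by linarith
qed

text \<open>A strictly increasing \<open>g\<close> into \<open>{..<N + M}\<close> has
  \<open>g i - i\<close> weakly increasing between 0 and \<open>M\<close>; reading it backwards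
  gives the parts.\<close>

lemma bij_betw_beta: "bij_betw (beta N) (part_box N M) (incr N {..<N + M})"
proof (rule bij_betw_byWitness[where f' = "\<lambda>g i. if i < N then g (N - 1 - i) - (N - 1 - i) else 0"])
  show "\<forall>p\<in>part_box N M. (\<lambda>i. if i < N then beta N p (N - 1 - i) - (N - 1 - i) else 0) = p"
  proof (intro ballI ext)
    fix p i assume "p \<in> part_box N M"
    then show "(if i < N then beta N p (N - 1 - i) - (N - 1 - i) else 0) = p i"
      using beta_apply[of "N - 1 - i" N p] by (cases "i < N") (auto simp: part_box_def)
  qed
  \<comment> \<open>Makes the truncated subtraction in the inverse map exact.\<close>
  have ge: "i \<le> g i" if "g \<in> incr N {..<N + M}" "i < N" for g i
    using that(2)
  proof (induction i)
    case (Suc i)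
    then have "g i < g (Suc i)" using that(1) by (auto simp: incr_def strict_mono_on_def)
    then show ?case using Suc by linarith
  qed simp
  show "\<forall>g\<in>incr N {..<N + M}. beta N (\<lambda>i. if i < N then g (N - 1 - i) - (N - 1 - i) else 0) = g"
  proof
    fix g assume g: "g \<in> incr N {..<N + M}"
    show "beta N (\<lambda>i. if i < N then g (N - 1 - i) - (N - 1 - i) else 0) = g"
    proof
      fix i
      show "beta N (\<lambda>i. if i < N then g (N - 1 - i) - (N - 1 - i) else 0) i = g i"
        using g ge[OF g, of i] by (cases "i < N") (auto simp: beta_def incr_def PiE_iff extensional_def)
    qed
  qed
  show "beta N ` part_box N M \<subseteq> incr N {..<N + M}"
  proof (intro image_subsetI)
    fix p assume p: "p \<in> part_box N M"
    then have "strict_mono_on {..<N} (beta N p)"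
      by (auto simp: strict_mono_on_def part_box_def intro: beta_less)
    moreover have "beta N p i < N + M" if "i < N" for i
      using p that by (auto simp: part_box_def beta_apply intro!: add_le_less_mono[of _ M i N, unfolded add.commute[of M]])
    ultimately show "beta N p \<in> incr N {..<N + M}"
      by (auto simp: incr_def PiE_iff beta_def)
  qed
  show "(\<lambda>g i. if i < N then g (N - 1 - i) - (N - 1 - i) else 0) ` incr N {..<N + M} \<subseteq> part_box N M"
  proof (intro image_subsetI)
    fix g assume g: "g \<in> incr N {..<N + M}"
    let ?p = "\<lambda>i. if i < N then g (N - 1 - i) - (N - 1 - i) else 0"
    \<comment> \<open>The \<open>N - 1 - i\<close> remaining strict increases must still fit below
      \<open>N + M\<close>.\<close>
    have up: "g i - i \<le> M" if "i < N" for i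
    proof -
      have "g i + d \<le> g (i + d)" if "i + d < N" for d
        using that
      proof (induction d)
        case (Suc d)
        then have "g (i + d) < g (i + Suc d)" using g by (auto simp: incr_def strict_mono_on_def)
        then show ?case using Suc by linarith
      qed simp
      from this[of "N - 1 - i"] have "g i + (N - 1 - i) \<le> g (N - 1)" using that by simp
      moreover have "g (N - 1) < N + M" using g that by (auto simp: incr_def PiE_iff)
      ultimately show ?thesis using that by linarith
    qed
    have step: "g i - i \<le> g j - j" if "i \<le> j" "j < N" for i j
      using that
    proof (induction rule: dec_induct)
      case (step n)
      then have "g n < g (Suc n)" using g by (auto simp: incr_def strict_mono_on_def)
      then show ?case using step by linarith
    qed simp
    have "antimono ?p"
    proof (rule antimonoI)
      fix x y :: nat assume "x \<le> y"
      then show "?p y \<le> ?p x"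
        by (cases "y < N") (use step[of "N - 1 - y" "N - 1 - x"] in simp_all)
    qed
    moreover have "finite {i. ?p i \<noteq> 0}" by (rule finite_subset[of _ "{..<N}"]) auto
    moreover have "?p i \<le> M" for i
      using up[of "N - 1 - i"] by (cases "i < N") simp_all
    ultimately show "?p \<in> part_box N M" by (auto simp: part_box_def partitions_def)
  qed
qed

lemma finite_part_box [simp]: "finite (part_box N M)"
  using bij_betw_finite[OF bij_betw_beta[of N M]] by simp

lemma part_box_subset: "part_box N M \<subseteq> partitions"
  by (auto simp: part_box_def)

lemma partition_in_part_box:
  assumes "p \<in> partitions"
  obtains n where "\<And>N M. n \<le> N \<Longrightarrow> n \<le> M \<Longrightarrow> p \<in> part_box N M"
proof -
  have "finite {i. p i \<noteq> 0}" using assms by (simp add: partitions_def)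
  then obtain m where m: "\<And>i. p i \<noteq> 0 \<Longrightarrow> i < m"
    using finite_nat_set_iff_bounded by auto
  have "p \<in> part_box N M" if "max m (p 0) \<le> N" "max m (p 0) \<le> M" for N M
  proof -
    have "p i \<le> M" for i
      using partitions_antimono[OF assms, of 0 i] that by linarith
    moreover have "p i = 0" if "N \<le> i" for i
      using m[of i] that \<open>max m (p 0) \<le> N\<close> by (cases "p i = 0") auto
    ultimately show ?thesis using assms by (simp add: part_box_def)
  qed
  then show ?thesis by (rule that)
qed

text \<open>The set \<open>{i. j < p i}\<close> is finite and closed downwards, hence an initial
  segment whose length is its cardinality.\<close>

lemma transpose_part_less_iff:
  assumes "p \<in> partitions"
  shows "i < transpose_part p j \<longleftrightarrow> j < p i"
proof -
  have fin: "finite {i. j < p i}"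
    by (rule finite_subset[of _ "{i. p i \<noteq> 0}"]) (use assms in \<open>auto simp: partitions_def\<close>)
  have down: "k \<in> {i. j < p i}" if "i \<in> {i. j < p i}" "k \<le> i" for i k
    using that(1) partitions_antimono[OF assms that(2)] by simp
  have "{i. j < p i} = {..<card {i. j < p i}}"
  proof (cases "{i. j < p i} = {}")
    case False
    define m where "m = Max {i. j < p i}"
    have "{i. j < p i} = {..m}"
      using down[OF Max_in[OF fin False]] Max_ge[OF fin] unfolding m_def by blast
    then show ?thesis by (simp add: lessThan_Suc_atMost)
  qed auto
  then show ?thesis unfolding transpose_part_def by blast
qed

lemma cells_eq:
  assumes "p \<in> part_box N M"
  shows "cells p = Sigma {..<N} (\<lambda>i. {..<p i})"
proof -
  have "i < N" if "j < p i" for i j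
    using assms that by (cases "i < N") (auto simp: part_box_def)
  then show ?thesis by (auto simp: cells_def)
qed

text \<open>In each row the hook lengths and the differences with the later shifted parts exhaust
  an initial interval, since both lists are repetition free and they share no value.\<close>

lemma hook_row:
  assumes p: "p \<in> part_box N M" and i: "i < N"
  shows "bij_betw (\<lambda>x. case x of Inl j \<Rightarrow> hook p (N - 1 - i) j | Inr j \<Rightarrow> beta N p i - beta N p j)
           ({..<p (N - 1 - i)} <+> {..<i}) {1..beta N p i}"
proof -
  have pp: "p \<in> partitions" using p by (simp add: part_box_def)
  \<comment> \<open>\<open>beta\<close> lists the parts from the smallest up, so its index
    \<open>i\<close> belongs to row \<open>N - 1 - i\<close>.\<close>
  define r where "r = N - 1 - i"
  let ?f = "\<lambda>x. case x of Inl j \<Rightarrow> hook p r j | Inr j \<Rightarrow> beta N p i - beta N p j"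
  let ?A = "{..<p r} <+> {..<i}"
  have hk: "hook p r j + r + j + 1 = p r + transpose_part p j" "1 \<le> hook p r j"
    "hook p r j \<le> beta N p i" if "j < p r" for j
  proof -
    have t: "r < transpose_part p j" using that transpose_part_less_iff[OF pp] by simp
    have "transpose_part p j \<le> N"
    proof (rule ccontr)
      assume "\<not> transpose_part p j \<le> N"
      then have "j < p N" using transpose_part_less_iff[OF pp, of N j] by simp
      then show False using p by (simp add: part_box_def)
    qed
    then show "hook p r j + r + j + 1 = p r + transpose_part p j" "1 \<le> hook p r j"
      "hook p r j \<le> beta N p i"
      using t that i by (auto simp: hook_def beta_apply r_def[symmetric]) (auto simp: r_def)
  qed
  have tm: "transpose_part p j' \<le> transpose_part p j" if "j \<le> j'" for j j'
    using that transpose_part_less_iff[OF pp] by (metis le_trans linorder_not_le order_less_imp_le)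
  have "inj_on ?f ?A"
  proof (rule inj_onI)
    fix x y assume xy: "x \<in> ?A" "y \<in> ?A" "?f x = ?f y"
    have LL: "j = j'" if "j < p r" "j' < p r" "hook p r j = hook p r j'" for j j'
      using hk(1)[OF that(1)] hk(1)[OF that(2)] that(3) tm[of j j'] tm[of j' j] by linarith
    have RR: "j = j'" if "j < i" "j' < i" "beta N p i - beta N p j = beta N p i - beta N p j'" for j j'
      using beta_less[OF pp that(1) i] beta_less[OF pp that(2) i] that(3)
        beta_less[OF pp, of j j' N] beta_less[OF pp, of j' j N] that(1,2) i
      by (metis diff_less_mono2 less_irrefl_nat linorder_neqE_nat order_less_trans)
    have LR: False if "j < p r" "k < i" "hook p r j = beta N p i - beta N p k" for j k
    proof -
      define s where "s = N - 1 - k"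
      have "beta N p i - beta N p k + p s + r = p r + s"
        using beta_less[OF pp that(2) i] that(2) i by (simp add: beta_apply s_def r_def)
      then have e: "transpose_part p j + p s = s + j + 1"
        using hk(1)[OF that(1)] that(3) by linarith
      \<comment> \<open>If \<open>(s, j)\<close> is a cell, the left side of \<open>e\<close> is at
        least \<open>s + j + 2\<close>; otherwise it is at most \<open>s + j\<close>. The value
        \<open>s + j + 1\<close> is never attained.\<close>
      show False
        using transpose_part_less_iff[OF pp, of s j] e by linarith
    qed
    show "x = y" using xy LL RR LR by (auto 4 3 split: sum.splits) (metis LR)+
  qed
  moreover have "?f ` ?A \<subseteq> {1..beta N p i}"
  proof (intro image_subsetI)
    fix x assume "x \<in> ?A"
    then consider j where "x = Inl j" "j < p r" | j where "x = Inr j" "j < i" by auto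
    then show "?f x \<in> {1..beta N p i}"
    proof cases
      case 1
      then show ?thesis using hk[of j] by simp
    next
      case 2
      then show ?thesis using beta_less[OF pp 2(2) i] by simp
    qed
  qed
  moreover have "card ?A = card {1..beta N p i}"
    using i by (simp add: card_Plus beta_apply r_def)
  ultimately show ?thesis
    unfolding r_def[symmetric] bij_betw_def
    by (metis card_image card_subset_eq finite_atLeastAtMost)
qed

text \<open>Row by row, hooks and differences of shifted parts complete each other to a generalised
  factorial, as in Frobenius's form of the hook length formula. An arbitrary \<open>f\<close> covers
  ordinary and q-deformed hooks at once.\<close>

lemma prod_hooks:
  fixes f :: "nat \<Rightarrow> 'a::comm_monoid_mult"
  assumes p: "p \<in> part_box N M"
  shows "(\<Prod>(i, j)\<in>cells p. f (hook p i j)) * (\<Prod>i<N. \<Prod>j<i. f (beta N p i - beta N p j)) =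
         (\<Prod>i<N. \<Prod>m=1..beta N p i. f m)"
proof -
  have "(\<Prod>m=1..beta N p i. f m) =
     (\<Prod>j<p (N - Suc i). f (hook p (N - Suc i) j)) * (\<Prod>j<i. f (beta N p i - beta N p j))"
    if "i < N" for i
    by (subst prod.reindex_bij_betw[OF hook_row[OF p that], symmetric])
       (simp add: prod.Plus)
  then have "(\<Prod>i<N. \<Prod>m=1..beta N p i. f m) =
     (\<Prod>i<N. \<Prod>j<p (N - Suc i). f (hook p (N - Suc i) j)) *
     (\<Prod>i<N. \<Prod>j<i. f (beta N p i - beta N p j))"
    by (simp add: prod.distrib)
  also have "(\<Prod>i<N. \<Prod>j<p (N - Suc i). f (hook p (N - Suc i) j)) =
     (\<Prod>i<N. \<Prod>j<p i. f (hook p i j))"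
    by (rule prod.nat_diff_reindex)
  also have "\<dots> = (\<Prod>(i, j)\<in>cells p. f (hook p i j))"
    by (simp add: cells_eq[OF p] prod.Sigma)
  finally show ?thesis by simp
qed

lemma part_size_part_box:
  assumes "p \<in> part_box N M"
  shows "part_size p = (\<Sum>i<N. p i)"
  unfolding part_size_def using assms by (intro sum.mono_neutral_left) (auto simp: part_box_def not_less[symmetric])

lemma part_b_part_box:
  assumes "p \<in> part_box N M"
  shows "part_b p = (\<Sum>i<N. i * p i)"
  unfolding part_b_def using assms by (intro sum.mono_neutral_left) (auto simp: part_box_def not_less[symmetric])

text \<open>The lower bound on \<open>n\<close> excludes the sites that come from the zero parts
  with index at least \<open>N\<close>: they all lie in \<open>Xi p\<close>, but
  \<open>beta N p\<close> does not list them.\<close>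

lemma half_integer_in_Xi:
  assumes p: "p \<in> part_box N M" and x: "- int N \<le> n"
  shows "real_of_int n + 1 / 2 \<in> Xi p \<longleftrightarrow> nat (n + int N) \<in> beta N p ` {..<N}"
proof
  assume "real_of_int n + 1 / 2 \<in> Xi p"
  then obtain i where i: "real_of_int n + 1 / 2 = real (p i) - real (i + 1) + 1 / 2"
    by (auto simp: Xi_def)
  then have n: "n = int (p i) - int i - 1" by linarith
  have "i < N"
  proof (rule ccontr)
    assume "\<not> i < N"
    then have "p i = 0" using p by (simp add: part_box_def)
    with n x \<open>\<not> i < N\<close> show False by linarith
  qed
  then have "nat (n + int N) = beta N p (N - 1 - i)"
    using n by (auto simp: beta_apply)
  then show "nat (n + int N) \<in> beta N p ` {..<N}"
    using \<open>i < N\<close> by (intro image_eqI[of _ _ "N - 1 - i"]) auto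
next
  assume "nat (n + int N) \<in> beta N p ` {..<N}"
  then obtain j where j: "j < N" "nat (n + int N) = p (N - 1 - j) + j" by (auto simp: beta_apply)
  then have "n = int (p (N - 1 - j)) - int (N - 1 - j) - 1"
    using x by linarith
  then have "real_of_int n + 1 / 2 = real (p (N - 1 - j)) - real ((N - 1 - j) + 1) + 1 / 2"
    by simp
  then show "real_of_int n + 1 / 2 \<in> Xi p" unfolding Xi_def by (rule range_eqI)
qed

section \<open>Jacobi--Trudi determinants of the principal and the Plancherel specialisation\<close>

text \<open>Passing from monomials to monic polynomials multiplies by an upper unitriangular matrix
  of coefficients.\<close>

lemma ddet_monic_poly:
  assumes deg: "\<And>k. k < N \<Longrightarrow> degree (P k) = k" and lead: "\<And>k. k < N \<Longrightarrow> coeff (P k) k = 1"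
  shows "ddet N (\<lambda>i k. poly (P k) (u i)) = ddet N (\<lambda>i k. u i ^ k)"
proof -
  have "ddet N (\<lambda>i k. poly (P k) (u i)) = ddet N (\<lambda>i k. \<Sum>j<N. u i ^ j * coeff (P k) j)"
  proof (rule ddet_cong)
    fix i k assume "i < N" "k < N"
    have "poly (P k) (u i) = (\<Sum>j\<le>k. coeff (P k) j * u i ^ j)"
      using deg[OF \<open>k < N\<close>] by (simp add: poly_altdef)
    also have "\<dots> = (\<Sum>j<N. u i ^ j * coeff (P k) j)"
      using \<open>k < N\<close> deg[OF \<open>k < N\<close>]
      by (intro sum.mono_neutral_cong_left) (auto simp: not_le intro: coeff_eq_0)
    finally show "poly (P k) (u i) = (\<Sum>j<N. u i ^ j * coeff (P k) j)" .
  qed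
  also have "\<dots> = ddet N (\<lambda>i j. u i ^ j) * ddet N (\<lambda>j k. coeff (P k) j)"
    by (rule ddet_mult)
  also have "ddet N (\<lambda>j k. coeff (P k) j) = 1"
    using deg lead by (subst ddet_upper_triangular) (auto intro: coeff_eq_0)
  finally show ?thesis by simp
qed

lemma ddet_Newton:
  fixes u c :: "nat \<Rightarrow> real"
  shows "ddet N (\<lambda>i k. \<Prod>m<k. (u i - c m)) = (\<Prod>i<N. \<Prod>j<i. u i - u j)"
proof -
  have *: "ddet N (\<lambda>i k. \<Prod>m<k. (u i - c m)) = ddet N (\<lambda>i k. u i ^ k)" for c :: "nat \<Rightarrow> real"
  proof -
    define P where "P k = (\<Prod>m<k. [:- c m, 1:])" for k
    have P: "degree (P k) = k \<and> coeff (P k) k = 1" for k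
    proof -
      have "degree (P k) = k"
        unfolding P_def by (subst degree_prod_eq_sum_degree) auto
      moreover have "lead_coeff (P k) = 1"
        unfolding P_def by (simp add: lead_coeff_prod)
      ultimately show ?thesis by simp
    qed
    have "(\<Prod>m<k. (u i - c m)) = poly (P k) (u i)" for i k
      by (simp add: P_def poly_prod)
    then show ?thesis using ddet_monic_poly[of N P u] P by simp
  qed
  \<comment> \<open>The value does not depend on the nodes; taking the points themselves as nodes
    makes the matrix lower triangular.\<close>
  have "ddet N (\<lambda>i k. \<Prod>m<k. (u i - c m)) = ddet N (\<lambda>i k. \<Prod>m<k. (u i - u m))"
    by (simp only: *)
  also have "\<dots> = (\<Prod>i<N. \<Prod>j<i. u i - u j)"
    by (rule ddet_lower_triangular) (auto intro!: prod_zero)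
  finally show ?thesis .
qed

lemma ddet_Vandermonde: "ddet N (\<lambda>i k. u i ^ k) = (\<Prod>i<N. \<Prod>j<i. u i - u j)"
  using ddet_Newton[of N u "\<lambda>_. 0"] by simp

text \<open>The guard encodes the convention that \<open>h\<close> vanishes at negative indices;
  truncated subtraction alone would give \<open>h 0\<close> there.\<close>

definition toep :: "(nat \<Rightarrow> real) \<Rightarrow> nat \<Rightarrow> nat \<Rightarrow> real" where
  "toep h k x = (if k \<le> x then h (x - k) else 0)"

text \<open>The Jacobi--Trudi determinant of a partition with at most \<open>N\<close> parts, for complete
  homogeneous functions \<open>h\<close>.\<close>

definition schur :: "(nat \<Rightarrow> real) \<Rightarrow> nat \<Rightarrow> (nat \<Rightarrow> nat) \<Rightarrow> real" where
  "schur h N p = ddet N (\<lambda>i k. toep h k (beta N p i))"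

lemma ddet_toep_identity:
  assumes "h 0 = 1"
  shows "ddet N (\<lambda>i k. toep h k i) = 1"
  by (subst ddet_lower_triangular) (auto simp: toep_def assms)

lemma sum_beta:
  assumes "p \<in> part_box N M"
  shows "(\<Sum>i<N. beta N p i) = part_size p + (\<Sum>i<N. i)"
proof -
  have "(\<Sum>i<N. beta N p i) = (\<Sum>i<N. p (N - Suc i) + i)"
    by (intro sum.cong) (auto simp: beta_apply)
  then show ?thesis
    by (simp add: sum.distrib part_size_part_box[OF assms] sum.nat_diff_reindex)
qed

text \<open>Homogeneity: in every nonvanishing Leibniz term the degrees
  \<open>beta N p i - s i\<close> add up to the size of the partition, because \<open>s\<close> only
  permutes the subtracted indices.\<close>

lemma schur_scale:
  assumes p: "p \<in> part_box N M"
  shows "schur (\<lambda>n. c ^ n * h n) N p = c ^ part_size p * schur h N p"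
proof -
  have "(\<Prod>i<N. toep (\<lambda>n. c ^ n * h n) (s i) (beta N p i)) =
     c ^ part_size p * (\<Prod>i<N. toep h (s i) (beta N p i))" if s: "s permutes {..<N}" for s
  proof (cases "\<forall>i<N. s i \<le> beta N p i")
    case True
    have "(\<Sum>i<N. beta N p i - s i) + (\<Sum>i<N. s i) = (\<Sum>i<N. beta N p i)"
      using True by (simp add: sum.distrib[symmetric])
    moreover have "(\<Sum>i<N. s i) = (\<Sum>i<N. i)"
      using sum.permute[OF s, of "\<lambda>i. i"] by (simp add: o_def)
    ultimately have "(\<Sum>i<N. beta N p i - s i) = part_size p"
      using sum_beta[OF p] by simp
    then have "(\<Prod>i<N. c ^ (beta N p i - s i)) = c ^ part_size p"
      by (simp add: power_sum[symmetric])
    then show ?thesis using True by (simp add: toep_def prod.distrib)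
  next
    case False
    then obtain i where i: "i < N" "\<not> s i \<le> beta N p i" by auto
    then have "(\<Prod>i<N. toep h (s i) (beta N p i)) = 0" for h
      by (intro prod_zero bexI[of _ i]) (auto simp: toep_def)
    then show ?thesis by (simp only: mult_zero_right)
  qed
  then show ?thesis
    unfolding schur_def ddet_Leibniz by (simp add: sum_distrib_left mult_ac)
qed

lemma sum_triangle: "(\<Sum>i<N. \<Sum>j<i. a j) = (\<Sum>j<N. (N - 1 - j) * a j)" for a :: "nat \<Rightarrow> nat"
proof (induction N)
  case (Suc N)
  have "(\<Sum>j<N. (N - j) * a j) = (\<Sum>j<N. (N - 1 - j) * a j + a j)"
  proof (intro sum.cong refl)
    fix j assume "j \<in> {..<N}"
    then have "N - j = Suc (N - 1 - j)" by auto
    then show "(N - j) * a j = (N - 1 - j) * a j + a j" by simp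
  qed
  then show ?case using Suc by (simp add: sum.distrib)
qed simp

text \<open>Covers both \<open>f m = 1 - q ^ m\<close> (with \<open>u l = q ^ l\<close>) and \<open>f m = m\<close> (with \<open>u l = l\<close>).\<close>

locale hook_function =
  fixes f u \<kappa> :: "nat \<Rightarrow> real"
  assumes factor: "m \<le> l \<Longrightarrow> f (l - m) = \<kappa> m * (u l - u m)"
    and nonzero: "0 < m \<Longrightarrow> f m \<noteq> 0"
begin

text \<open>This is \<open>n!\<close> for \<open>f m = m\<close> and the q-Pochhammer symbol
  \<open>(q; q)_n\<close> for \<open>f m = 1 - q ^ m\<close>.\<close>

definition F :: "nat \<Rightarrow> real" where "F n = (\<Prod>m=1..n. f m)"

lemma F_Suc: "F (Suc n) = F n * f (Suc n)" by (simp add: F_def)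

lemma F_nonzero: "F n \<noteq> 0" using nonzero by (auto simp: F_def)

lemma kappa_nonzero: "\<kappa> m \<noteq> 0"
  using factor[of m "Suc m"] nonzero[of 1] by auto

lemma F_split: "k \<le> l \<Longrightarrow> F l = F (l - k) * (\<Prod>m<k. f (l - m))"
proof (induction k)
  case (Suc k)
  then have "l - k = Suc (l - Suc k)" by simp
  then have "F (l - k) = F (l - Suc k) * f (l - k)" by (metis F_Suc)
  then show ?case using Suc by (simp add: mult_ac)
qed simp

text \<open>Apart from the row factor \<open>1 / F l\<close> and a column factor, the entry is a
  Newton polynomial in \<open>u l\<close> with nodes \<open>u 0, ..., u (k - 1)\<close>. Its zeros
  reproduce the zeros of \<open>toep\<close>, so a single formula covers the whole matrix.\<close>

lemma toep_F: "toep (\<lambda>n. 1 / F n) k l = 1 / F l * ((\<Prod>m<k. \<kappa> m) * (\<Prod>m<k. u l - u m))"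
proof (cases "k \<le> l")
  case True
  have "(\<Prod>m<k. f (l - m)) = (\<Prod>m<k. \<kappa> m) * (\<Prod>m<k. u l - u m)"
    using True by (simp add: prod.distrib[symmetric] factor)
  moreover have "1 / F (l - k) = 1 / F l * (\<Prod>m<k. f (l - m))"
    using F_split[OF True] F_nonzero[of l] F_nonzero[of "l - k"] by (simp add: field_simps)
  ultimately show ?thesis using True by (simp add: toep_def)
next
  case False
  then have "(\<Prod>m<k. u l - u m) = 0" by (intro prod_zero bexI[of _ l]) auto
  then show ?thesis using False by (simp add: toep_def)
qed

lemma ddet_toep_F:
  "ddet N (\<lambda>i k. toep (\<lambda>n. 1 / F n) k (g i)) =
   (\<Prod>i<N. 1 / F (g i)) * ((\<Prod>i<N. \<Prod>j<i. \<kappa> j) * (\<Prod>i<N. \<Prod>j<i. u (g i) - u (g j)))"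
  unfolding toep_F ddet_scale_rows ddet_scale_cols ddet_Newton ..

text \<open>The determinant is a Vandermonde product over factorials; \<open>prod_hooks\<close>
  converts that quotient into hooks, and the ratios of \<open>\<kappa>\<close> are what remains from
  writing the differences of \<open>u\<close> through \<open>f\<close>.\<close>

lemma schur_hooks:
  assumes p: "p \<in> part_box N M"
  shows "schur (\<lambda>n. 1 / F n) N p =
    (\<Prod>i<N. \<Prod>j<i. \<kappa> j / \<kappa> (beta N p j)) * (\<Prod>(i, j)\<in>cells p. 1 / f (hook p i j))"
proof -
  have pp: "p \<in> partitions" using p by (simp add: part_box_def)
  let ?C = "\<Prod>(i, j)\<in>cells p. f (hook p i j)"
  let ?D = "\<Prod>i<N. \<Prod>j<i. f (beta N p i - beta N p j)"
  have CD: "?C * ?D = (\<Prod>i<N. F (beta N p i))"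
    using prod_hooks[OF p, of f] by (simp add: F_def)
  have "?C * ?D \<noteq> 0" unfolding CD using F_nonzero by simp
  then have nz: "?C \<noteq> 0" "?D \<noteq> 0" unfolding mult_eq_0_iff by blast+
  have "(\<Prod>i<N. \<Prod>j<i. u (beta N p i) - u (beta N p j)) =
        (\<Prod>i<N. \<Prod>j<i. f (beta N p i - beta N p j) / \<kappa> (beta N p j))"
  proof (intro prod.cong refl)
    fix i j assume "i \<in> {..<N}" "j \<in> {..<i}"
    then have "beta N p j \<le> beta N p i" using beta_less[OF pp, of j i N] by simp
    then show "u (beta N p i) - u (beta N p j) = f (beta N p i - beta N p j) / \<kappa> (beta N p j)"
      by (simp add: factor kappa_nonzero)
  qed
  then have "schur (\<lambda>n. 1 / F n) N p =
     (\<Prod>i<N. \<Prod>j<i. \<kappa> j / \<kappa> (beta N p j)) * (?D / (\<Prod>i<N. F (beta N p i)))"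
    unfolding schur_def ddet_toep_F by (simp add: prod_dividef)
  also have "?D / (\<Prod>i<N. F (beta N p i)) = 1 / ?C"
    unfolding CD[symmetric] using nz by simp
  also have "1 / ?C = (\<Prod>(i, j)\<in>cells p. 1 / f (hook p i j))"
    by (simp add: prod_dividef case_prod_unfold)
  finally show ?thesis .
qed

end

section \<open>The hook formulas for the two specialisations\<close>

definition qfac :: "real \<Rightarrow> nat \<Rightarrow> real" where "qfac q n = (\<Prod>m=1..n. 1 - q ^ m)"

lemma hook_function_q:
  assumes "0 < q" "q < (1::real)"
  shows "hook_function (\<lambda>m. 1 - q ^ m) (\<lambda>l. q ^ l) (\<lambda>m. - inverse (q ^ m))"
proof
  show "1 - q ^ (l - m) = - inverse (q ^ m) * (q ^ l - q ^ m)" if "m \<le> l" for l m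
    using that assms by (simp add: power_diff field_simps)
  show "1 - q ^ m \<noteq> 0" if "0 < m" for m
    using assms that power_less_one_iff[of q m] by simp
qed

lemma hook_function_nat: "hook_function real real (\<lambda>_. 1)"
  by unfold_locales auto

lemma schur_q:
  assumes q: "0 < q" "q < (1::real)" and p: "p \<in> part_box N M"
  shows "schur (\<lambda>n. c ^ n / qfac q n) N p =
    c ^ part_size p * q ^ part_b p * (\<Prod>(i, j)\<in>cells p. 1 / (1 - q ^ hook p i j))"
proof -
  interpret hook_function "\<lambda>m. 1 - q ^ m" "\<lambda>l. q ^ l" "\<lambda>m. - inverse (q ^ m)"
    by (rule hook_function_q[OF q])
  have F: "F n = qfac q n" for n by (simp add: F_def qfac_def)
  have "(\<Prod>i<N. \<Prod>j<i. (- inverse (q ^ j)) / (- inverse (q ^ beta N p j))) =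
        (\<Prod>i<N. \<Prod>j<i. q ^ p (N - 1 - j))"
    using q by (intro prod.cong refl) (auto simp: beta_apply power_add field_simps)
  \<comment> \<open>The part in row \<open>r = N - 1 - j\<close> occurs once for each of the
    \<open>r\<close> indices \<open>i\<close> above \<open>j\<close>, so the exponent is the sum of
    \<open>r * p r\<close>, which is \<open>part_b p\<close>.\<close>
  also have "\<dots> = q ^ (\<Sum>i<N. \<Sum>j<i. p (N - 1 - j))"
    by (simp add: power_sum)
  also have "(\<Sum>i<N. \<Sum>j<i. p (N - 1 - j)) = (\<Sum>j<N. (N - Suc j) * p (N - Suc j))"
    using sum_triangle[of "\<lambda>j. p (N - 1 - j)" N] by simp
  also have "\<dots> = part_b p"
    unfolding part_b_part_box[OF p] by (rule sum.nat_diff_reindex)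
  finally show ?thesis
    using schur_hooks[OF p] schur_scale[OF p, of c "\<lambda>n. 1 / F n"] by (simp add: F)
qed

lemma schur_nat:
  assumes p: "p \<in> part_box N M"
  shows "schur (\<lambda>n. c ^ n / fact n) N p =
    c ^ part_size p * (\<Prod>(i, j)\<in>cells p. 1 / real (hook p i j))"
proof -
  interpret hook_function real real "\<lambda>_. 1" by (rule hook_function_nat)
  have "F n = fact n" for n by (simp add: F_def fact_prod)
  then show ?thesis
    using schur_hooks[OF p] schur_scale[OF p, of c "\<lambda>n. 1 / F n"] by simp
qed

section \<open>The q-exponential function and the MacMahon product\<close>

lemma qfac_0 [simp]: "qfac q 0 = 1" by (simp add: qfac_def)

lemma qfac_Suc: "qfac q (Suc n) = qfac q n * (1 - q ^ Suc n)" by (simp add: qfac_def)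

lemma qfac_pos:
  assumes "0 < q" "q < (1::real)"
  shows "0 < qfac q n"
  unfolding qfac_def using assms by (intro prod_pos) (auto simp: power_less_one_iff)

lemma qfac_antimono:
  assumes "0 < q" "q < (1::real)" "m \<le> n"
  shows "qfac q n \<le> qfac q m"
  using \<open>m \<le> n\<close>
proof (induction rule: dec_induct)
  case (step n)
  have "qfac q (Suc n) \<le> qfac q n * 1"
    unfolding qfac_Suc using assms qfac_pos[OF assms(1,2), of n] by (intro mult_left_mono) auto
  with step show ?case by simp
qed simp

text \<open>Positivity of the limit \<open>(q; q)_\<infinity>\<close> matters: it bounds
  \<open>1 / qfac q n\<close> uniformly and makes quotients of late \<open>qfac\<close> values tend
  to 1.\<close>

lemma qfac_tendsto:
  assumes "0 < q" "q < (1::real)"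
  obtains L where "0 < L" "qfac q \<longlonglongrightarrow> L"
proof -
  define f where "f n = 1 - q ^ Suc n" for n
  have fnz: "f n \<noteq> 0" for n
    using power_Suc_less_one[of q n] assms by (simp add: f_def)
  have "summable (\<lambda>n. norm (f n - 1))"
    using assms by (simp add: f_def summable_mult summable_geometric)
  then have cp: "convergent_prod f"
    by (intro abs_convergent_prod_imp_convergent_prod summable_imp_abs_convergent_prod)
  have lim: "(\<lambda>n. \<Prod>i\<le>n. f i) \<longlonglongrightarrow> prodinf f" and nz: "prodinf f \<noteq> 0"
    using convergent_prod_LIMSEQ[OF cp] prodinf_nonzero[OF cp fnz] by auto
  have eq: "(\<Prod>i\<le>n. f i) = qfac q (Suc n)" for n
    by (induction n) (simp_all add: f_def qfac_Suc)
  then have 1: "(\<lambda>n. qfac q (Suc n)) \<longlonglongrightarrow> prodinf f" using lim by simp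
  then have "qfac q \<longlonglongrightarrow> prodinf f" by (rule LIMSEQ_imp_Suc)
  moreover have "0 \<le> prodinf f"
    by (rule LIMSEQ_le_const[OF 1]) (use qfac_pos[OF assms] less_imp_le in blast)
  ultimately show ?thesis using nz that[of "prodinf f"] by simp
qed

lemma inverse_qfac_bound:
  assumes "0 < q" "q < (1::real)"
  obtains C where "1 \<le> C" "\<And>n. 1 / qfac q n \<le> C"
proof -
  obtain L where L: "0 < L" "qfac q \<longlonglongrightarrow> L" by (rule qfac_tendsto[OF assms])
  have "L \<le> qfac q n" for n
    by (rule LIMSEQ_le_const2[OF L(2)]) (use qfac_antimono[OF assms] in blast)
  then have "1 / qfac q n \<le> 1 / L" for n using L(1) by (simp add: frac_le)
  then show ?thesis using that[of "1 / L"] by (metis div_by_1 qfac_0)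
qed

lemma summable_q_exponential:
  assumes "0 < q" "q < (1::real)" "\<bar>y\<bar> < 1"
  shows "summable (\<lambda>n. y ^ n / qfac q n)"
proof -
  obtain C where C: "1 \<le> C" "\<And>n. 1 / qfac q n \<le> C"
    using inverse_qfac_bound[OF assms(1,2)] by blast
  show ?thesis
  proof (rule summable_comparison_test'[of "\<lambda>n. C * \<bar>y\<bar> ^ n"])
    show "summable (\<lambda>n. C * \<bar>y\<bar> ^ n)" using assms by (intro summable_mult summable_geometric) auto
    show "norm (y ^ n / qfac q n) \<le> C * \<bar>y\<bar> ^ n" for n
      using mult_right_mono[OF C(2), of "\<bar>y\<bar> ^ n" n] qfac_pos[OF assms(1,2), of n]
      by (simp add: abs_mult power_abs)
  qed
qed

text \<open>Euler's q-exponential, the series of the infinite product of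
  \<open>1 / (1 - y * q ^ m)\<close>.\<close>

definition qexp :: "real \<Rightarrow> real \<Rightarrow> real" where "qexp q y = (\<Sum>n. y ^ n / qfac q n)"

lemma qexp_shift:
  assumes "0 < q" "q < (1::real)" "\<bar>y\<bar> < 1"
  shows "qexp q (y * q) = (1 - y) * qexp q y"
proof -
  have yq: "\<bar>y * q\<bar> < 1"
    using assms mult_strict_mono[of "\<bar>y\<bar>" 1 q 1] by (simp add: abs_mult)
  note s1 = summable_q_exponential[OF assms] and s2 = summable_q_exponential[OF assms(1,2) yq]
  have "qexp q y - qexp q (y * q) = (\<Sum>n. y ^ n / qfac q n - (y * q) ^ n / qfac q n)"
    unfolding qexp_def by (rule suminf_diff[OF s1 s2])
  also have "\<dots> = (\<Sum>n. y ^ Suc n / qfac q (Suc n) - (y * q) ^ Suc n / qfac q (Suc n))"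
    using suminf_split_head[OF summable_diff[OF s1 s2]] by simp
  also have "\<dots> = (\<Sum>n. y * (y ^ n / qfac q n))"
  proof (rule suminf_cong)
    fix n
    have "1 - q ^ Suc n \<noteq> 0" using assms(1,2) by (simp add: power_less_one_iff less_imp_neq[symmetric] del: power_Suc)
    then show "y ^ Suc n / qfac q (Suc n) - (y * q) ^ Suc n / qfac q (Suc n) = y * (y ^ n / qfac q n)"
      using qfac_pos[OF assms(1,2), of n]
      unfolding qfac_Suc power_mult_distrib by (simp add: divide_simps) (simp add: algebra_simps)
  qed
  also have "\<dots> = y * qexp q y" unfolding qexp_def by (rule suminf_mult[OF s1])
  finally show ?thesis by (simp add: algebra_simps)
qed

lemma qexp_prod:
  assumes "0 < q" "q < (1::real)" "0 \<le> y" "y < 1"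
  shows "qexp q y = (\<Prod>m<L. 1 / (1 - y * q ^ m)) * qexp q (y * q ^ L)"
proof (induction L)
  case (Suc L)
  have "y * q ^ L \<le> y * 1" using assms by (intro mult_left_mono) (auto simp: power_le_one)
  then have 1: "\<bar>y * q ^ L\<bar> < 1" and 2: "y * q ^ L < 1" using assms by auto
  show ?case using Suc qexp_shift[OF assms(1,2) 1] 2 by (simp add: mult_ac)
qed simp

lemma qexp_ge_1:
  assumes "0 < q" "q < (1::real)" "0 \<le> y" "y < 1"
  shows "1 \<le> qexp q y"
proof -
  have "(\<Sum>n<1. y ^ n / qfac q n) \<le> qexp q y"
    unfolding qexp_def using assms qfac_pos[OF assms(1,2)]
    by (intro sum_le_suminf summable_q_exponential) (auto intro: divide_nonneg_pos)
  then show ?thesis by simp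
qed

lemma qexp_ge_prod:
  assumes "0 < q" "q < (1::real)" "0 \<le> y" "y < 1"
  shows "(\<Prod>m<L. 1 / (1 - y * q ^ m)) \<le> qexp q y"
proof -
  have le: "y * q ^ m < 1" for m
    using assms mult_left_mono[of "q ^ m" 1 y] power_le_one[of q m] by linarith
  have "(\<Prod>m<L. 1 / (1 - y * q ^ m)) * 1 \<le> (\<Prod>m<L. 1 / (1 - y * q ^ m)) * qexp q (y * q ^ L)"
    using le assms by (intro mult_left_mono qexp_ge_1 prod_nonneg) (auto simp: less_imp_le)
  then show ?thesis using qexp_prod[OF assms, of L] by simp
qed

text \<open>The iterated shift leaves the remainder \<open>qexp q (y * q ^ L)\<close>, which tends
  to \<open>qexp q 0 = 1\<close> by continuity of the power series.\<close>

lemma qexp_prod_tendsto: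
  assumes "0 < q" "q < (1::real)" "0 \<le> y" "y < 1"
  shows "(\<lambda>L. \<Prod>m<L. 1 / (1 - y * q ^ m)) \<longlonglongrightarrow> qexp q y"
proof -
  have le: "y * q ^ m < 1" for m
    using assms mult_left_mono[of "q ^ m" 1 y] power_le_one[of q m] by linarith
  have "isCont (\<lambda>x. \<Sum>n. 1 / qfac q n * x ^ n) 0"
    by (rule isCont_powser[of _ "1/2"]) (use summable_q_exponential[OF assms(1,2), of "1/2"] in \<open>auto simp: mult.commute\<close>)
  then have "isCont (qexp q) 0" by (simp add: qexp_def[abs_def])
  moreover have "(\<lambda>L. y * q ^ L) \<longlonglongrightarrow> 0"
    using assms by (intro tendsto_mult_right_zero LIMSEQ_power_zero) auto
  ultimately have "(\<lambda>L. qexp q (y * q ^ L)) \<longlonglongrightarrow> qexp q 0" by (rule isCont_tendsto_compose)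
  moreover have "qexp q 0 = 1"
    using qexp_shift[OF assms(1,2), of 0] suminf_split_head[OF summable_q_exponential[OF assms(1,2), of 0]]
    by (simp add: qexp_def)
  ultimately have "(\<lambda>L. qexp q y / qexp q (y * q ^ L)) \<longlonglongrightarrow> qexp q y / 1"
    by (intro tendsto_intros) auto
  moreover have "qexp q y / qexp q (y * q ^ L) = (\<Prod>m<L. 1 / (1 - y * q ^ m))" for L
    using qexp_prod[OF assms, of L] qexp_ge_1[OF assms(1,2), of "y * q ^ L"] le[of L] assms by simp
  ultimately show ?thesis by simp
qed

text \<open>Grouping by antidiagonals: \<open>n\<close> is a sum \<open>j + m\<close> in
  \<open>n + 1\<close> ways, whence the exponents in MacMahon's product.\<close>

lemma prod_triangle:
  fixes a :: "nat \<Rightarrow> 'a::comm_monoid_mult"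
  shows "(\<Prod>j<N. \<Prod>m<N - j. a (j + m)) = (\<Prod>n<N. a n ^ Suc n)"
proof (induction N)
  case (Suc N)
  have "(\<Prod>j<Suc N. \<Prod>m<Suc N - j. a (j + m)) = (\<Prod>j<Suc N. (\<Prod>m<N - j. a (j + m)) * a N)"
  proof (intro prod.cong refl)
    fix j assume "j \<in> {..<Suc N}"
    then have "Suc N - j = Suc (N - j)" "j + (N - j) = N" by auto
    then show "(\<Prod>m<Suc N - j. a (j + m)) = (\<Prod>m<N - j. a (j + m)) * a N" by simp
  qed
  also have "\<dots> = (\<Prod>j<N. \<Prod>m<N - j. a (j + m)) * a N ^ Suc N"
    by (simp add: prod.distrib mult_ac)
  finally show ?case by (simp only: Suc prod.lessThan_Suc)
qed simp

text \<open>In the array \<open>a (j + m)\<close> the \<open>qexp\<close> factors are complete rows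
  and the partial MacMahon products are triangles. All entries are at least 1, the triangle of size
  \<open>N\<close> lies in the first \<open>N\<close> rows, and each \<open>N\<close> by
  \<open>L\<close> rectangle lies in the triangle of size \<open>N + L\<close>; this squeezes the
  row products.\<close>

lemma MacMahon_tendsto:
  assumes q: "0 < q" "q < (1::real)" and xi: "0 \<le> \<xi>" "\<xi> < (1::real)"
  shows "(\<lambda>N. \<Prod>j<N. qexp q (\<xi>\<^sup>2 * q * q ^ j)) \<longlonglongrightarrow> MacMahon \<xi> q"
    and "1 \<le> MacMahon \<xi> q"
proof -
  define c where "c = \<xi>\<^sup>2 * q"
  have c: "0 \<le> c" "c < 1"
    using q xi power_less_one_iff[of \<xi> 2] mult_strict_mono'[of "\<xi>\<^sup>2" 1 q 1] by (auto simp: c_def power2_less_1_iff abs_square_less_1)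
  have cq: "c * q ^ n < 1" "0 \<le> c * q ^ n" for n
    using c q mult_left_mono[of "q ^ n" 1 c] power_le_one[of q n] by auto
  define a where "a n = 1 / (1 - c * q ^ n)" for n
  have a: "1 \<le> a n" for n using cq[of n] by (simp add: a_def)
  \<comment> \<open>Convergence of the infinite product is proved for the reciprocal factors, whose
    distance from 1 Bernoulli's inequality bounds by \<open>(n + 1) * q ^ n\<close>.\<close>
  define b where "b n = (1 - c * q ^ n) ^ Suc n" for n
  have "norm (b n - 1) \<le> real (Suc n) * q ^ n" for n
  proof -
    have "1 + real (Suc n) * (- (c * q ^ n)) \<le> (1 + - (c * q ^ n)) ^ Suc n"
      using cq[of n] by (intro Bernoulli_inequality) auto
    then have "1 - real (Suc n) * (c * q ^ n) \<le> b n" unfolding b_def by (simp del: of_nat_Suc power_Suc)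
    moreover have "b n \<le> 1" unfolding b_def using cq[of n] by (intro power_le_one) auto
    moreover have "real (Suc n) * (c * q ^ n) \<le> real (Suc n) * (1 * q ^ n)"
      using c q by (intro mult_left_mono mult_right_mono) auto
    ultimately show ?thesis unfolding real_norm_def mult_1 by linarith
  qed
  then have bnd: "norm (norm (b n - 1)) \<le> real (Suc n) * q ^ n" for n by simp
  have sq: "summable (\<lambda>n. real (Suc n) * q ^ n)"
    using geometric_deriv_sums[of q] q by (auto simp: sums_iff)
  have "summable (\<lambda>n. norm (b n - 1))"
    by (rule summable_comparison_test'[OF sq, of 0]) (rule bnd)
  then have "convergent_prod b"
    by (intro abs_convergent_prod_imp_convergent_prod summable_imp_abs_convergent_prod)
  then have conv: "convergent_prod (\<lambda>n. inverse (b n))" by simp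
  have "inverse (b n) = 1 / (1 - \<xi>\<^sup>2 * q ^ (n + 1)) ^ (n + 1)" for n
    by (simp add: b_def c_def mult_ac inverse_eq_divide)
  then have "prodinf (\<lambda>n. inverse (b n)) = MacMahon \<xi> q"
    by (simp only: MacMahon_def)
  then have "(\<lambda>N. \<Prod>n\<le>N. inverse (b n)) \<longlonglongrightarrow> MacMahon \<xi> q"
    using convergent_prod_LIMSEQ[OF conv] by simp
  moreover have inv: "inverse (b n) = a n ^ Suc n" for n
    by (simp add: a_def b_def power_one_over inverse_eq_divide)
  ultimately have "(\<lambda>N. \<Prod>n<Suc N. a n ^ Suc n) \<longlonglongrightarrow> MacMahon \<xi> q"
    by (simp only: inv lessThan_Suc_atMost)
  then have lim: "(\<lambda>N. \<Prod>n<N. a n ^ Suc n) \<longlonglongrightarrow> MacMahon \<xi> q" by (rule LIMSEQ_imp_Suc)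
  have a1: "1 \<le> a n ^ Suc n" for n using a by (rule one_le_power)
  have mono: "(\<Prod>n<N. a n ^ Suc n) \<le> (\<Prod>n<N'. a n ^ Suc n)" if "N \<le> N'" for N N'
    using that a1 by (intro prod_mono2) (auto intro: order_trans[OF zero_le_one])
  have M: "(\<Prod>n<N. a n ^ Suc n) \<le> MacMahon \<xi> q" for N
    by (rule LIMSEQ_le_const[OF lim]) (use mono in blast)
  show "1 \<le> MacMahon \<xi> q" using M[of 0] by simp
  have as: "1 / (1 - (c * q ^ j) * q ^ m) = a (j + m)" for j m by (simp add: a_def power_add mult_ac)
  show "(\<lambda>N. \<Prod>j<N. qexp q (\<xi>\<^sup>2 * q * q ^ j)) \<longlonglongrightarrow> MacMahon \<xi> q"
  proof (rule tendsto_sandwich[OF _ _ lim tendsto_const])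
    show "\<forall>\<^sub>F N in sequentially. (\<Prod>n<N. a n ^ Suc n) \<le> (\<Prod>j<N. qexp q (\<xi>\<^sup>2 * q * q ^ j))"
    proof (intro always_eventually allI)
      fix N
      show "(\<Prod>n<N. a n ^ Suc n) \<le> (\<Prod>j<N. qexp q (\<xi>\<^sup>2 * q * q ^ j))"
        unfolding prod_triangle[symmetric] c_def[symmetric]
        using qexp_ge_prod[OF q cq(2) cq(1)] a unfolding as
        by (intro prod_mono conjI prod_nonneg) (auto intro: order_trans[OF zero_le_one])
    qed
    show "\<forall>\<^sub>F N in sequentially. (\<Prod>j<N. qexp q (\<xi>\<^sup>2 * q * q ^ j)) \<le> MacMahon \<xi> q"
    proof (intro always_eventually allI)
      fix N
      have "(\<lambda>L. \<Prod>j<N. \<Prod>m<L. a (j + m)) \<longlonglongrightarrow> (\<Prod>j<N. qexp q (c * q ^ j))"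
        using qexp_prod_tendsto[OF q cq(2) cq(1)] unfolding as by (intro tendsto_prod) auto
      moreover have "(\<Prod>j<N. \<Prod>m<L. a (j + m)) \<le> MacMahon \<xi> q" for L
      proof -
        have a0: "0 \<le> a n" for n using a[of n] by simp
        have "(\<Prod>j<N. \<Prod>m<L. a (j + m)) \<le> (\<Prod>j<N. \<Prod>m<N + L - j. a (j + m))"
          using a a0 by (intro prod_mono conjI prod_nonneg prod_mono2) auto
        also have "\<dots> \<le> (\<Prod>j<N + L. \<Prod>m<N + L - j. a (j + m))"
          using a a0 by (intro prod_mono2) (auto intro!: prod_nonneg prod_ge_1)
        also have "\<dots> \<le> MacMahon \<xi> q" unfolding prod_triangle by (rule M)
        finally show ?thesis .
      qed
      ultimately show "(\<Prod>j<N. qexp q (\<xi>\<^sup>2 * q * q ^ j)) \<le> MacMahon \<xi> q"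
        unfolding c_def[symmetric] by (intro LIMSEQ_le_const2) auto
    qed
  qed
qed

section \<open>Normalisation by the Cauchy identity\<close>

text \<open>One side has the variables \<open>1, q, ..., q ^ (N - 1)\<close>; their Schur functions are the ratios
  of the determinants \<open>V\<close> and appear here as truncations of the principal specialisation.\<close>

lemma Cauchy_identity_limit:
  assumes q: "0 < q" "q < (1::real)" and h: "summable (\<lambda>n. \<bar>h n\<bar>)"
  shows "(\<lambda>M. \<Sum>p\<in>part_box N M. schur (\<lambda>n. 1 / qfac q n) N p *
            (\<Prod>i<N. qfac q (beta N p i) / qfac q i) * schur h N p)
         \<longlonglongrightarrow> (\<Prod>j<N. \<Sum>n. h n * (q ^ j) ^ n)"
proof -
  interpret hook_function "\<lambda>m. 1 - q ^ m" "\<lambda>l. q ^ l" "\<lambda>m. - inverse (q ^ m)"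
    by (rule hook_function_q[OF q])
  have F: "F n = qfac q n" for n by (simp add: F_def qfac_def)
  have qf0: "qfac q n \<noteq> 0" for n using qfac_pos[OF q, of n] by simp
  \<comment> \<open>The alternant in the variables \<open>q ^ k\<close>; read along rows it is a
    Vandermonde matrix in the points \<open>q ^ g i\<close>.\<close>
  define V where "V g = ddet N (\<lambda>i k. (q ^ k) ^ g i)" for g :: "nat \<Rightarrow> nat"
  define kap where "kap = (\<Prod>i<N. \<Prod>j<i. - inverse (q ^ j))"
  have JT: "ddet N (\<lambda>i k. toep (\<lambda>n. 1 / qfac q n) k (g i)) =
      (\<Prod>i<N. 1 / qfac q (g i)) * (kap * V g)" for g
  proof -
    have "V g = ddet N (\<lambda>i k. (q ^ g i) ^ k)"
      unfolding V_def by (simp add: power_mult[symmetric] mult.commute)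
    then show ?thesis
      using ddet_toep_F[of N g] unfolding F kap_def ddet_Vandermonde by simp
  qed
  \<comment> \<open>The identity map enumerates the empty partition, whose Jacobi-Trudi determinant
    is 1; this fixes the constant and shows that it is nonzero.\<close>
  have V1: "(\<Prod>i<N. 1 / qfac q i) * (kap * V (\<lambda>i. i)) = 1"
    using JT[of "\<lambda>i. i"] ddet_toep_identity[of "\<lambda>n. 1 / qfac q n" N] by simp
  then have V0: "V (\<lambda>i. i) \<noteq> 0" and kap0: "kap \<noteq> 0" by auto
  have ratio: "schur (\<lambda>n. 1 / qfac q n) N p * (\<Prod>i<N. qfac q (beta N p i) / qfac q i) =
      V (beta N p) / V (\<lambda>i. i)" for p
  proof -
    have "(\<Prod>i<N. 1 / qfac q (beta N p i)) * (\<Prod>i<N. qfac q (beta N p i) / qfac q i) =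
        (\<Prod>i<N. 1 / qfac q i)"
      unfolding prod.distrib[symmetric] using qf0 by (intro prod.cong refl) simp
    moreover have "(\<Prod>i<N. 1 / qfac q i) * kap = 1 / V (\<lambda>i. i)"
      using V1 V0 by (simp add: field_simps)
    moreover have "schur (\<lambda>n. 1 / qfac q n) N p * (\<Prod>i<N. qfac q (beta N p i) / qfac q i) =
        ((\<Prod>i<N. 1 / qfac q (beta N p i)) * (\<Prod>i<N. qfac q (beta N p i) / qfac q i)) * kap * V (beta N p)"
      unfolding schur_def JT by (simp only: mult_ac)
    ultimately show ?thesis by simp
  qed
  have CB: "(\<Sum>p\<in>part_box N M. schur (\<lambda>n. 1 / qfac q n) N p *
            (\<Prod>i<N. qfac q (beta N p i) / qfac q i) * schur h N p) =
       ddet N (\<lambda>i j. \<Sum>x<N + M. (q ^ i) ^ x * toep h j x) / V (\<lambda>i. i)" for M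
  proof -
    have "ddet N (\<lambda>i j. \<Sum>x<N + M. (q ^ i) ^ x * toep h j x) =
      (\<Sum>g\<in>incr N {..<N + M}. V g * ddet N (\<lambda>i k. toep h k (g i)))"
      unfolding V_def by (rule Cauchy_Binet) simp
    also have "\<dots> = (\<Sum>p\<in>part_box N M. V (beta N p) * schur h N p)"
      unfolding schur_def by (rule sum.reindex_bij_betw[OF bij_betw_beta, symmetric])
    finally show ?thesis by (simp add: ratio sum_divide_distrib)
  qed
  \<comment> \<open>Substituting \<open>x = n + j\<close> splits off \<open>q ^ (i * j)\<close>, so
    the limiting matrix is the alternant of the empty partition with row \<open>i\<close> scaled by
    a generating function value.\<close>
  have entry: "(\<lambda>M. \<Sum>x<N + M. (q ^ i) ^ x * toep h j x) \<longlonglongrightarrow> (\<Sum>n. h n * (q ^ i) ^ n) * (q ^ j) ^ i" for i j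
  proof -
    have "summable (\<lambda>n. h n * (q ^ i) ^ n)"
    proof (rule summable_comparison_test'[OF h, of 0])
      fix n :: nat
      have "\<bar>h n\<bar> * \<bar>(q ^ i) ^ n\<bar> \<le> \<bar>h n\<bar> * 1"
        using q by (intro mult_left_mono) (auto simp: power_le_one)
      then show "norm (h n * (q ^ i) ^ n) \<le> \<bar>h n\<bar>" by (simp add: abs_mult)
    qed
    then have "(\<lambda>n. h n * (q ^ i) ^ n * (q ^ j) ^ i) sums ((\<Sum>n. h n * (q ^ i) ^ n) * (q ^ j) ^ i)"
      by (intro sums_mult2 summable_sums)
    moreover have "h n * (q ^ i) ^ n * (q ^ j) ^ i = (q ^ i) ^ (n + j) * toep h j (n + j)" for n
      by (simp add: toep_def power_add power_mult[symmetric] mult_ac)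
    ultimately have "(\<lambda>n. (q ^ i) ^ (n + j) * toep h j (n + j)) sums ((\<Sum>n. h n * (q ^ i) ^ n) * (q ^ j) ^ i)"
      by simp
    then have "(\<lambda>x. (q ^ i) ^ x * toep h j x) sums ((\<Sum>n. h n * (q ^ i) ^ n) * (q ^ j) ^ i)"
      by (subst (asm) sums_zero_iff_shift) (auto simp: toep_def)
    then have "(\<lambda>K. \<Sum>x<K. (q ^ i) ^ x * toep h j x) \<longlonglongrightarrow> (\<Sum>n. h n * (q ^ i) ^ n) * (q ^ j) ^ i"
      by (simp add: sums_def)
    from LIMSEQ_ignore_initial_segment[OF this, of N] show ?thesis by (simp add: add.commute)
  qed
  have "(\<lambda>M. ddet N (\<lambda>i j. \<Sum>x<N + M. (q ^ i) ^ x * toep h j x) / V (\<lambda>i. i)) \<longlonglongrightarrow>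
      ddet N (\<lambda>i j. (\<Sum>n. h n * (q ^ i) ^ n) * (q ^ j) ^ i) / V (\<lambda>i. i)"
    using V0 by (intro tendsto_intros entry)
  also have "ddet N (\<lambda>i j. (\<Sum>n. h n * (q ^ i) ^ n) * (q ^ j) ^ i) / V (\<lambda>i. i) =
      (\<Prod>j<N. \<Sum>n. h n * (q ^ j) ^ n)"
    using V0 unfolding ddet_scale_rows V_def by simp
  finally show ?thesis unfolding CB .
qed

lemma qfac_ratio_le_1:
  assumes "0 < q" "q < (1::real)"
  shows "(\<Prod>i<N. qfac q (beta N p i) / qfac q i) \<le> 1"
  using assms qfac_antimono[OF assms] less_imp_le[OF qfac_pos[OF assms]] qfac_pos[OF assms]
  by (intro prod_le_1 conjI) (auto simp: beta_apply intro!: divide_nonneg_nonneg)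

text \<open>Counted from the largest part, only the boundedly many factors of nonzero parts can
  differ from 1, and each is a quotient of two \<open>qfac\<close> values with the same positive
  limit.\<close>

lemma qfac_ratio_tendsto:
  assumes q: "0 < q" "q < (1::real)" and p: "p \<in> partitions"
  shows "(\<lambda>N. \<Prod>i<N. qfac q (beta N p i) / qfac q i) \<longlonglongrightarrow> 1"
proof -
  obtain n where n: "\<And>N M. n \<le> N \<Longrightarrow> n \<le> M \<Longrightarrow> p \<in> part_box N M"
    using partition_in_part_box[OF p] by blast
  obtain L where L: "0 < L" "qfac q \<longlonglongrightarrow> L" by (rule qfac_tendsto[OF q])
  have eq: "(\<Prod>i<N. qfac q (beta N p i) / qfac q i) =
      (\<Prod>r<n. qfac q (p r + (N - Suc r)) / qfac q (N - Suc r))" if "n \<le> N" for N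
  proof -
    have "(\<Prod>i<N. qfac q (beta N p i) / qfac q i) = (\<Prod>i<N. qfac q (p (N - Suc i) + i) / qfac q i)"
      by (intro prod.cong) (auto simp: beta_apply)
    also have "\<dots> = (\<Prod>i<N. qfac q (p (N - Suc i) + (N - Suc (N - Suc i))) / qfac q (N - Suc (N - Suc i)))"
      by (intro prod.cong) auto
    also have "\<dots> = (\<Prod>r<N. qfac q (p r + (N - Suc r)) / qfac q (N - Suc r))"
      by (rule prod.nat_diff_reindex)
    also have "\<dots> = (\<Prod>r<n. qfac q (p r + (N - Suc r)) / qfac q (N - Suc r))"
    proof (rule prod.mono_neutral_right)
      show "\<forall>i\<in>{..<N} - {..<n}. qfac q (p i + (N - Suc i)) / qfac q (N - Suc i) = 1"
      proof
        fix i assume "i \<in> {..<N} - {..<n}"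
        then have "p i = 0" using n[of n n] by (auto simp: part_box_def)
        then show "qfac q (p i + (N - Suc i)) / qfac q (N - Suc i) = 1"
          using qfac_pos[OF q, of "N - Suc i"] by simp
      qed
    qed (use that in auto)
    finally show ?thesis .
  qed
  have "(\<lambda>N. \<Prod>r<n. qfac q (p r + (N - Suc r)) / qfac q (N - Suc r)) \<longlonglongrightarrow> (\<Prod>r<n. L / L)"
  proof (intro tendsto_intros)
    fix r
    show "(\<lambda>N. qfac q (p r + (N - Suc r))) \<longlonglongrightarrow> L"
      by (rule filterlim_compose[OF L(2)]) real_asymp
    show "(\<lambda>N. qfac q (N - Suc r)) \<longlonglongrightarrow> L"
      by (rule filterlim_compose[OF L(2)]) real_asymp
  qed (use L in auto)
  then have "(\<lambda>N. \<Prod>r<n. qfac q (p r + (N - Suc r)) / qfac q (N - Suc r)) \<longlonglongrightarrow> 1"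
    using L by simp
  then show ?thesis
    by (rule Lim_transform_eventually) (use eq in \<open>auto intro!: eventually_sequentiallyI[of n]\<close>)
qed

text \<open>The ratio \<open>R N p\<close> truncates one specialisation to \<open>N\<close>
  variables. It tends to 1 for each fixed \<open>p\<close>, so finite sums of \<open>W\<close> are
  at most \<open>Z\<close>; it never exceeds 1, so the truncated totals, and with them
  \<open>Z\<close>, are at most the sum of \<open>W\<close>.\<close>

theorem Schur_weight_has_sum:
  assumes q: "0 < q" "q < (1::real)" and h: "summable (\<lambda>n. \<bar>h n\<bar>)"
    and W: "\<And>p. p \<in> partitions \<Longrightarrow> 0 \<le> W p"
    and JT: "\<And>N M p. p \<in> part_box N M \<Longrightarrow> W p = schur (\<lambda>n. 1 / qfac q n) N p * schur h N p"
    and Z: "(\<lambda>N. \<Prod>j<N. \<Sum>n. h n * (q ^ j) ^ n) \<longlonglongrightarrow> Z"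
  shows "(W has_sum Z) partitions"
proof -
  define R where "R N p = (\<Prod>i<N. qfac q (beta N p i) / qfac q i)" for N p
  have R: "0 \<le> R N p" "R N p \<le> 1" for N p
    using qfac_ratio_le_1[OF q, of N p] qfac_pos[OF q]
    by (auto simp: R_def less_imp_le intro!: prod_nonneg divide_nonneg_pos)
  define S where "S N M = (\<Sum>p\<in>part_box N M. W p * R N p)" for N M
  define ZN where "ZN N = (\<Prod>j<N. \<Sum>n. h n * (q ^ j) ^ n)" for N
  have S: "(\<lambda>M. S N M) \<longlonglongrightarrow> ZN N" for N
  proof -
    have "S N M = (\<Sum>p\<in>part_box N M. schur (\<lambda>n. 1 / qfac q n) N p *
            (\<Prod>i<N. qfac q (beta N p i) / qfac q i) * schur h N p)" for M
      unfolding S_def R_def by (intro sum.cong refl) (simp add: JT)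
    then show ?thesis using Cauchy_identity_limit[OF q h, of N] by (simp add: ZN_def)
  qed
  have Wbox: "0 \<le> W p" if "p \<in> part_box N M" for N M p
    using that part_box_subset W by blast
  have S_le: "S N M \<le> ZN N" for N M
  proof (rule LIMSEQ_le_const[OF S])
    have "S N M \<le> S N M'" if "M \<le> M'" for M'
    proof -
      have "part_box N M \<subseteq> part_box N M'" using that by (auto simp: part_box_def intro: le_trans)
      then show ?thesis
        unfolding S_def using Wbox[of _ N M'] R by (intro sum_mono2) auto
    qed
    then show "\<exists>n0. \<forall>n\<ge>n0. S N M \<le> S N n" by blast
  qed
  have upper: "sum W A \<le> Z" if A: "finite A" "A \<subseteq> partitions" for A
  proof -
    have "\<forall>p\<in>A. \<exists>n. \<forall>N M. n \<le> N \<longrightarrow> n \<le> M \<longrightarrow> p \<in> part_box N M"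
      using A(2) partition_in_part_box by (metis subsetD)
    then obtain n where n: "\<And>p N M. p \<in> A \<Longrightarrow> n p \<le> N \<Longrightarrow> n p \<le> M \<Longrightarrow> p \<in> part_box N M"
      by metis
    define n0 where "n0 = Max (insert 0 (n ` A))"
    have n0: "n p \<le> n0" if "p \<in> A" for p using that A(1) by (auto simp: n0_def)
    have "(\<lambda>N. \<Sum>p\<in>A. W p * R N p) \<longlonglongrightarrow> (\<Sum>p\<in>A. W p * 1)"
      unfolding R_def using A by (intro tendsto_intros qfac_ratio_tendsto[OF q]) auto
    moreover have "(\<Sum>p\<in>A. W p * R N p) \<le> ZN N" if "n0 \<le> N" for N
    proof -
      have "A \<subseteq> part_box N N" using n n0 that by (meson order_trans subsetI)
      then have "(\<Sum>p\<in>A. W p * R N p) \<le> S N N"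
        unfolding S_def using Wbox R by (intro sum_mono2) auto
      also have "\<dots> \<le> ZN N" by (rule S_le)
      finally show ?thesis .
    qed
    ultimately show ?thesis
      using LIMSEQ_le[OF _ Z[folded ZN_def]] by auto
  qed
  define T where "T = (SUP A\<in>{A. finite A \<and> A \<subseteq> partitions}. sum W A)"
  have bdd: "bdd_above (sum W ` {A. A \<subseteq> partitions \<and> finite A})"
    using upper by (auto intro!: bdd_aboveI[of _ Z])
  have sum_T: "(W has_sum T) partitions"
    unfolding T_def by (rule nonneg_bdd_above_has_sum[OF W bdd])
  have "T \<le> Z"
    unfolding T_def using upper by (intro cSUP_least) auto
  moreover have "Z \<le> T"
  proof (rule LIMSEQ_le_const2[OF Z[folded ZN_def]])
    have "S N M \<le> T" for N M
    proof -
      have "S N M \<le> (\<Sum>p\<in>part_box N M. W p)"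
        unfolding S_def using Wbox R by (intro sum_mono mult_left_le) auto
      also have "\<dots> \<le> T"
        by (rule finite_sum_le_has_sum[OF sum_T]) (use part_box_subset W in auto)
      finally show ?thesis .
    qed
    then have "ZN N \<le> T" for N by (intro LIMSEQ_le_const2[OF S]) auto
    then show "\<exists>N. \<forall>n\<ge>N. ZN n \<le> T" by blast
  qed
  ultimately show ?thesis using sum_T by simp
qed

section \<open>Uniformly bounded kernels on finite windows\<close>

text \<open>Multiplying the Toeplitz matrix of \<open>h\<close> by the inverse of its leading square block, the
  Toeplitz matrix of the inverse sequence \<open>g\<close>.\<close>

definition reduced :: "(nat \<Rightarrow> real) \<Rightarrow> (nat \<Rightarrow> real) \<Rightarrow> nat \<Rightarrow> nat \<Rightarrow> nat \<Rightarrow> real" where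
  "reduced h g N i x = (\<Sum>k<N. toep g i k * toep h k x)"

lemma weighted_geometric_sums:
  assumes "0 \<le> t" "t < (1::real)"
  shows "(\<Sum>n<N. real (Suc n) * t ^ n) \<le> 1 / (1 - t)\<^sup>2" "(\<Sum>n<N. t ^ n) \<le> 1 / (1 - t)"
proof -
  have "(\<lambda>n. real (Suc n) * t ^ n) sums (1 / (1 - t)\<^sup>2)"
    using geometric_deriv_sums[of t] assms by simp
  then show "(\<Sum>n<N. real (Suc n) * t ^ n) \<le> 1 / (1 - t)\<^sup>2"
    using assms sum_le_suminf[of "\<lambda>n. real (Suc n) * t ^ n" "{..<N}"] by (simp add: sums_iff)
  have "(\<lambda>n. t ^ n) sums (1 / (1 - t))"
    using geometric_sums[of t] assms by simp
  then show "(\<Sum>n<N. t ^ n) \<le> 1 / (1 - t)"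
    using assms sum_le_suminf[of "\<lambda>n. t ^ n" "{..<N}"] by (simp add: sums_iff)
qed

lemma sum_lessThan_add: "(\<Sum>x<N + M. f x) = (\<Sum>x<N. f x) + (\<Sum>a<M. f (N + a :: nat) :: real)"
  by (induction M) simp_all

text \<open>The generating functions of \<open>h\<close> and \<open>g\<close> are reciprocal, as for
  complete homogeneous and signed elementary symmetric functions. Geometric decay of both makes the
  reduced entries small.\<close>

locale Toeplitz_inverse =
  fixes h g :: "nat \<Rightarrow> real" and C t :: real
  assumes convolution: "(\<Sum>m\<le>n. g m * h (n - m)) = (if n = 0 then 1 else 0)"
    and h_bound: "\<bar>h n\<bar> \<le> C * t ^ n" and g_bound: "\<bar>g n\<bar> \<le> C * t ^ n"
    and h0: "h 0 = 1" and C: "1 \<le> C" and t: "0 \<le> t" "t < 1"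
begin

lemma g0: "g 0 = 1"
  using convolution[of 0] h0 by simp

lemma reduced_left:
  assumes "i < N" "x < N"
  shows "reduced h g N i x = (if i = x then 1 else 0)"
proof (cases "i \<le> x")
  case True
  have "reduced h g N i x = (\<Sum>k\<in>{i..x}. g (k - i) * h (x - k))"
    unfolding reduced_def using assms by (intro sum.mono_neutral_cong_right) (auto simp: toep_def)
  also have "\<dots> = (\<Sum>m\<le>x - i. g m * h (x - i - m))"
    by (rule sum.reindex_bij_witness[of _ "\<lambda>m. m + i" "\<lambda>k. k - i"]) (use True in auto)
  finally show ?thesis unfolding convolution using True by auto
next
  case False
  then show ?thesis by (auto simp: reduced_def toep_def intro!: sum.neutral)
qed

text \<open>The \<open>N - i\<close> terms of the convolution all have the same order, because the
  indices of \<open>g\<close> and \<open>h\<close> add up to \<open>N + a - i\<close> whatever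
  \<open>k\<close> is.\<close>

lemma reduced_right:
  assumes "i < N"
  shows "\<bar>reduced h g N i (N + a)\<bar> \<le> C\<^sup>2 * (real (N - i) * t ^ (N - 1 - i)) * t ^ a"
proof -
  have "\<bar>reduced h g N i (N + a)\<bar> \<le> (\<Sum>k<N. \<bar>toep g i k * toep h k (N + a)\<bar>)"
    unfolding reduced_def by (rule sum_abs)
  also have "\<dots> = (\<Sum>k\<in>{i..<N}. \<bar>g (k - i)\<bar> * \<bar>h (N + a - k)\<bar>)"
    by (intro sum.mono_neutral_cong_right) (auto simp: toep_def abs_mult)
  also have "\<dots> \<le> (\<Sum>k\<in>{i..<N}. C\<^sup>2 * t ^ (N - 1 - i) * t ^ a)"
  proof (rule sum_mono)
    fix k assume k: "k \<in> {i..<N}"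
    have "\<bar>g (k - i)\<bar> * \<bar>h (N + a - k)\<bar> \<le> (C * t ^ (k - i)) * (C * t ^ (N + a - k))"
      using C t by (intro mult_mono g_bound h_bound) auto
    also have "\<dots> = C\<^sup>2 * t ^ ((k - i) + (N + a - k))"
      by (simp add: power_add power2_eq_square)
    also have "(k - i) + (N + a - k) = (N - 1 - i) + a + 1" using k by auto
    \<comment> \<open>One factor \<open>t\<close> is given up so that the weights become the terms
      \<open>(n + 1) * t ^ n\<close> with \<open>n = N - 1 - i\<close>.\<close>
    also have "C\<^sup>2 * t ^ ((N - 1 - i) + a + 1) \<le> C\<^sup>2 * t ^ ((N - 1 - i) + a)"
      using t by (intro mult_left_mono power_decreasing) auto
    finally show "\<bar>g (k - i)\<bar> * \<bar>h (N + a - k)\<bar> \<le> C\<^sup>2 * t ^ (N - 1 - i) * t ^ a"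
      by (simp add: power_add mult_ac)
  qed
  also have "\<dots> = C\<^sup>2 * (real (N - i) * t ^ (N - 1 - i)) * t ^ a" by simp
  finally show ?thesis .
qed

lemma sum_weights: "(\<Sum>i<N. real (N - i) * t ^ (N - 1 - i)) \<le> 1 / (1 - t)\<^sup>2"
proof -
  have "(\<Sum>i<N. real (N - i) * t ^ (N - 1 - i)) = (\<Sum>i<N. real (Suc (N - Suc i)) * t ^ (N - Suc i))"
    by (intro sum.cong) (auto simp: Suc_diff_Suc)
  also have "\<dots> = (\<Sum>n<N. real (Suc n) * t ^ n)" by (rule sum.nat_diff_reindex)
  finally show ?thesis using weighted_geometric_sums(1)[OF t, of N] by simp
qed

lemma reduced_row:
  assumes "i < N"
  shows "(\<Sum>a<M. \<bar>reduced h g N i (N + a)\<bar>) \<le> C\<^sup>2 / (1 - t) * (real (N - i) * t ^ (N - 1 - i))"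
proof -
  have "(\<Sum>a<M. \<bar>reduced h g N i (N + a)\<bar>) \<le> (\<Sum>a<M. C\<^sup>2 * (real (N - i) * t ^ (N - 1 - i)) * t ^ a)"
    by (intro sum_mono reduced_right assms)
  also have "\<dots> = C\<^sup>2 * (real (N - i) * t ^ (N - 1 - i)) * (\<Sum>a<M. t ^ a)"
    by (simp add: sum_distrib_left)
  also have "\<dots> \<le> C\<^sup>2 * (real (N - i) * t ^ (N - 1 - i)) * (1 / (1 - t))"
    using t by (intro mult_left_mono weighted_geometric_sums) auto
  finally show ?thesis by simp
qed

lemma reduced_column: "(\<Sum>i<N. \<bar>reduced h g N i x\<bar>) \<le> C\<^sup>2 / (1 - t)\<^sup>2"
proof (cases "x < N")
  case True
  have "(\<Sum>i<N. \<bar>reduced h g N i x\<bar>) = (\<Sum>i<N. if i = x then 1 else 0)"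
    by (intro sum.cong) (auto simp: reduced_left True)
  also have "\<dots> = 1" using True by simp
  also have "1 \<le> C\<^sup>2 / (1 - t)\<^sup>2"
    using C t power_le_one[of "1 - t" 2] one_le_power[of C 2] by (simp add: le_divide_eq)
  finally show ?thesis .
next
  case False
  define a where "a = x - N"
  have x: "x = N + a" using False by (simp add: a_def)
  have "(\<Sum>i<N. \<bar>reduced h g N i x\<bar>) \<le> (\<Sum>i<N. C\<^sup>2 * (real (N - i) * t ^ (N - 1 - i)) * t ^ a)"
    unfolding x by (intro sum_mono reduced_right) auto
  also have "\<dots> \<le> (\<Sum>i<N. C\<^sup>2 * (real (N - i) * t ^ (N - 1 - i)) * 1)"
    using t by (intro sum_mono mult_left_mono power_le_one) auto
  also have "\<dots> = C\<^sup>2 * (\<Sum>i<N. real (N - i) * t ^ (N - 1 - i))"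
    by (simp add: sum_distrib_left)
  also have "\<dots> \<le> C\<^sup>2 * (1 / (1 - t)\<^sup>2)" by (intro mult_left_mono sum_weights) auto
  finally show ?thesis by simp
qed

lemma ddet_reduced: "ddet N (\<lambda>i k. reduced h g N k (f i)) = ddet N (\<lambda>i k. toep h k (f i))"
proof -
  have "ddet N (\<lambda>i k. reduced h g N k (f i)) = ddet N (\<lambda>i k. \<Sum>l<N. toep h l (f i) * toep g k l)"
    by (simp add: reduced_def mult.commute)
  also have "\<dots> = ddet N (\<lambda>i l. toep h l (f i)) * ddet N (\<lambda>l k. toep g k l)"
    by (rule ddet_mult)
  also have "ddet N (\<lambda>l k. toep g k l) = 1"
    by (subst ddet_lower_triangular) (auto simp: toep_def g0)
  finally show ?thesis by simp
qed

end

lemma schur_empty: "h 0 = 1 \<Longrightarrow> schur h N (\<lambda>_. 0) = 1"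
  using ddet_toep_identity[of h N] by (simp add: schur_def beta_apply cong: ddet_cong)

lemma empty_part_box: "(\<lambda>_. 0) \<in> part_box N M"
  by (auto simp: part_box_def partitions_def antimono_def)

text \<open>\<open>W\<close> carries no index \<open>N\<close>: every box containing
  \<open>p\<close> must produce the same weight, so the growing windows all sample one fixed
  weight.\<close>

locale Schur_pair = A: Toeplitz_inverse h1 g1 C t + B: Toeplitz_inverse h2 g2 C t
  for h1 g1 h2 g2 C t +
  fixes W :: "(nat \<Rightarrow> nat) \<Rightarrow> real"
  assumes W_nonneg: "p \<in> partitions \<Longrightarrow> 0 \<le> W p"
    and W_schur: "p \<in> part_box N M \<Longrightarrow> W p = schur h1 N p * schur h2 N p"
begin

text \<open>The squared factor is the column bound of the two reduced families; the exponential
  bounds the inverse Gram matrix, through \<open>1 + x \<le> exp x\<close> applied to the row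
  sums.\<close>

definition kernel_bound :: real where
  "kernel_bound = (C\<^sup>2 / (1 - t)\<^sup>2)\<^sup>2 * exp ((C\<^sup>2 / (1 - t) * (C\<^sup>2 / (1 - t)\<^sup>2)) * (1 / (1 - t)\<^sup>2))"

text \<open>In the reduced form the Gram matrix is a perturbation of the identity whose row sums are
  summable uniformly in \<open>N\<close>; this bounds its inverse and hence the kernel.\<close>

lemma window_kernel:
  obtains K :: "nat \<Rightarrow> nat \<Rightarrow> real" where "\<And>x y. \<bar>K x y\<bar> \<le> kernel_bound"
    "\<And>k z. z ` {..<k} \<subseteq> {..<N + N} \<Longrightarrow> inj_on z {..<k} \<Longrightarrow>
      (\<Sum>p | p \<in> part_box N N \<and> z ` {..<k} \<subseteq> beta N p ` {..<N}. W p) =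
      (\<Sum>p\<in>part_box N N. W p) * ddet k (\<lambda>a b. K (z a) (z b))"
proof -
  define \<phi> where "\<phi> = reduced h1 g1 N"
  define \<psi> where "\<psi> = reduced h2 g2 N"
  define c where "c = C\<^sup>2 / (1 - t) * (C\<^sup>2 / (1 - t)\<^sup>2)"
  define G where "G i j = (\<Sum>x<N + N. \<phi> i x * \<psi> j x)" for i j
  define r where "r i = 1 + c * (real (N - i) * t ^ (N - 1 - i))" for i
  have c0: "0 \<le> c" unfolding c_def using A.t by simp
  have w: "ddet N (\<lambda>i k. \<phi> k (beta N p i)) * ddet N (\<lambda>i k. \<psi> k (beta N p i)) = W p"
    if "p \<in> part_box N N" for p
    unfolding \<phi>_def \<psi>_def A.ddet_reduced B.ddet_reduced W_schur[OF that] schur_def ..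
  have detG: "ddet N G = (\<Sum>p\<in>part_box N N. W p)"
  proof -
    have "ddet N G = (\<Sum>g\<in>incr N {..<N + N}. ddet N (\<lambda>i k. \<phi> k (g i)) * ddet N (\<lambda>i k. \<psi> k (g i)))"
      unfolding G_def[abs_def] by (rule Cauchy_Binet) simp
    also have "\<dots> = (\<Sum>p\<in>part_box N N. W p)"
      by (subst sum.reindex_bij_betw[OF bij_betw_beta, symmetric]) (simp add: w)
    finally show ?thesis .
  qed
  have "1 = W (\<lambda>_. 0)"
    using W_schur[OF empty_part_box[of 0 0]] schur_empty[of h1 0] schur_empty[of h2 0] A.h0 B.h0 by simp
  also have "\<dots> \<le> (\<Sum>p\<in>part_box N N. W p)"
    using W_nonneg part_box_subset empty_part_box by (intro member_le_sum) auto
  finally have det1: "1 \<le> ddet N G" by (simp add: detG)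
  have row: "(\<Sum>j<N. \<bar>G i j\<bar>) \<le> r i" if i: "i < N" for i
  proof -
    \<comment> \<open>On the square block the columns of both families are unit vectors and
      contribute the identity; only the columns beyond it perturb.\<close>
    have G: "G i j = (if i = j then 1 else 0) + (\<Sum>a<N. \<phi> i (N + a) * \<psi> j (N + a))" if "j < N" for j
    proof -
      have "G i j = (\<Sum>x<N. \<phi> i x * \<psi> j x) + (\<Sum>a<N. \<phi> i (N + a) * \<psi> j (N + a))"
        unfolding G_def by (rule sum_lessThan_add)
      also have "(\<Sum>x<N. \<phi> i x * \<psi> j x) = (\<Sum>x<N. if x = i then (if i = j then 1 else 0) else 0)"
        using i that by (intro sum.cong) (auto simp: \<phi>_def \<psi>_def A.reduced_left B.reduced_left)
      also have "\<dots> = (if i = j then 1 else 0)" using i by simp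
      finally show ?thesis .
    qed
    have "(\<Sum>j<N. \<bar>G i j\<bar>) \<le> (\<Sum>j<N. (if i = j then 1 else 0) + (\<Sum>a<N. \<bar>\<phi> i (N + a)\<bar> * \<bar>\<psi> j (N + a)\<bar>))"
    proof (rule sum_mono)
      fix j assume "j \<in> {..<N}"
      have "\<bar>\<Sum>a<N. \<phi> i (N + a) * \<psi> j (N + a)\<bar> \<le> (\<Sum>a<N. \<bar>\<phi> i (N + a) * \<psi> j (N + a)\<bar>)" by (rule sum_abs)
      then show "\<bar>G i j\<bar> \<le> (if i = j then 1 else 0) + (\<Sum>a<N. \<bar>\<phi> i (N + a)\<bar> * \<bar>\<psi> j (N + a)\<bar>)"
        using \<open>j \<in> {..<N}\<close> G[of j] abs_triangle_ineq[of "1" "\<Sum>a<N. \<phi> i (N + a) * \<psi> j (N + a)"]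
        by (cases "i = j") (simp_all add: abs_mult)
    qed
    also have "\<dots> = 1 + (\<Sum>a<N. \<bar>\<phi> i (N + a)\<bar> * (\<Sum>j<N. \<bar>\<psi> j (N + a)\<bar>))"
      using i by (simp add: sum.distrib sum_distrib_left) (rule sum.swap)
    also have "\<dots> \<le> 1 + (\<Sum>a<N. \<bar>\<phi> i (N + a)\<bar> * (C\<^sup>2 / (1 - t)\<^sup>2))"
      unfolding \<psi>_def by (intro add_left_mono sum_mono mult_left_mono B.reduced_column) auto
    also have "\<dots> = 1 + (\<Sum>a<N. \<bar>\<phi> i (N + a)\<bar>) * (C\<^sup>2 / (1 - t)\<^sup>2)"
      by (simp only: sum_distrib_right)
    also have "\<dots> \<le> 1 + (C\<^sup>2 / (1 - t) * (real (N - i) * t ^ (N - 1 - i))) * (C\<^sup>2 / (1 - t)\<^sup>2)"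
      unfolding \<phi>_def by (intro add_left_mono mult_right_mono A.reduced_row i) auto
    finally show ?thesis by (simp add: r_def c_def mult_ac)
  qed
  have r1: "1 \<le> r i" for i unfolding r_def using c0 A.t by simp
  have "(\<Prod>i<N. r i) \<le> exp (\<Sum>i<N. c * (real (N - i) * t ^ (N - 1 - i)))"
    unfolding r_def using c0 A.t by (intro prod_le_exp_sum) auto
  also have "\<dots> \<le> exp (c * (1 / (1 - t)\<^sup>2))"
    unfolding exp_le_cancel_iff sum_distrib_left[symmetric]
    by (rule mult_left_mono[OF A.sum_weights c0])
  finally have pr: "(\<Prod>i<N. r i) \<le> exp (c * (1 / (1 - t)\<^sup>2))" .
  obtain e where e: "\<And>i j. i < N \<Longrightarrow> j < N \<Longrightarrow> (\<Sum>l<N. G i l * e l j) = (if i = j then 1 else 0)"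
    "\<And>i j. i < N \<Longrightarrow> j < N \<Longrightarrow> \<bar>e i j\<bar> \<le> (\<Prod>i<N. r i)"
    using bounded_right_inverse[of N G r] row r1 det1 by blast
  define K where "K x y = (\<Sum>j<N. \<psi> j x * (\<Sum>m<N. e j m * \<phi> m y))" for x y
  have "\<bar>K x y\<bar> \<le> kernel_bound" for x y
  proof -
    have "\<bar>K x y\<bar> \<le> (\<Sum>j<N. \<bar>\<psi> j x\<bar> * (exp (c * (1 / (1 - t)\<^sup>2)) * (C\<^sup>2 / (1 - t)\<^sup>2)))"
      unfolding K_def
    proof (rule order_trans[OF sum_abs], unfold abs_mult, intro sum_mono mult_left_mono)
      fix j assume j: "j \<in> {..<N}"
      have "\<bar>\<Sum>m<N. e j m * \<phi> m y\<bar> \<le> (\<Sum>m<N. exp (c * (1 / (1 - t)\<^sup>2)) * \<bar>\<phi> m y\<bar>)"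
        using j order_trans[OF e(2) pr]
        by (intro order_trans[OF sum_abs] sum_mono) (auto simp: abs_mult intro!: mult_right_mono)
      also have "\<dots> = exp (c * (1 / (1 - t)\<^sup>2)) * (\<Sum>m<N. \<bar>\<phi> m y\<bar>)" by (simp add: sum_distrib_left)
      also have "\<dots> \<le> exp (c * (1 / (1 - t)\<^sup>2)) * (C\<^sup>2 / (1 - t)\<^sup>2)"
        unfolding \<phi>_def by (intro mult_left_mono A.reduced_column) auto
      finally show "\<bar>\<Sum>m<N. e j m * \<phi> m y\<bar> \<le> exp (c * (1 / (1 - t)\<^sup>2)) * (C\<^sup>2 / (1 - t)\<^sup>2)" .
    qed auto
    also have "\<dots> = (\<Sum>j<N. \<bar>\<psi> j x\<bar>) * (exp (c * (1 / (1 - t)\<^sup>2)) * (C\<^sup>2 / (1 - t)\<^sup>2))"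
      by (simp only: sum_distrib_right)
    also have "\<dots> \<le> C\<^sup>2 / (1 - t)\<^sup>2 * (exp (c * (1 / (1 - t)\<^sup>2)) * (C\<^sup>2 / (1 - t)\<^sup>2))"
      unfolding \<psi>_def by (intro mult_right_mono B.reduced_column) auto
    also have "\<dots> = kernel_bound"
      unfolding kernel_bound_def c_def power2_eq_square[of "C\<^sup>2 / (1 - t)\<^sup>2"] by (simp only: mult_ac)
    finally show ?thesis .
  qed
  moreover have "(\<Sum>p | p \<in> part_box N N \<and> z ` {..<k} \<subseteq> beta N p ` {..<N}. W p) =
      (\<Sum>p\<in>part_box N N. W p) * ddet k (\<lambda>a b. K (z a) (z b))"
    if z: "z ` {..<k} \<subseteq> {..<N + N}" "inj_on z {..<k}" for k z
  proof -
    have "bij_betw (beta N) {p \<in> part_box N N. z ` {..<k} \<subseteq> beta N p ` {..<N}}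
        {g \<in> incr N {..<N + N}. z ` {..<k} \<subseteq> g ` {..<N}}"
      using bij_betw_beta[of N N] unfolding bij_betw_def by (auto intro: inj_on_subset)
    then have "(\<Sum>p | p \<in> part_box N N \<and> z ` {..<k} \<subseteq> beta N p ` {..<N}.
          ddet N (\<lambda>i k. \<phi> k (beta N p i)) * ddet N (\<lambda>i k. \<psi> k (beta N p i))) =
        (\<Sum>g | g \<in> incr N {..<N + N} \<and> z ` {..<k} \<subseteq> g ` {..<N}.
          ddet N (\<lambda>i k. \<phi> k (g i)) * ddet N (\<lambda>i k. \<psi> k (g i)))"
      by (rule sum.reindex_bij_betw)
    also have "\<dots> = ddet N G * ddet k (\<lambda>a b. K (z a) (z b))"
      unfolding G_def[abs_def]
      by (rule biorthogonal_correlation[OF _ z, of N \<phi> \<psi> e K]) (use e(1) in \<open>auto simp: G_def K_def\<close>)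
    finally show ?thesis by (simp add: w detG)
  qed
  ultimately show ?thesis by (rule that)
qed

end

section \<open>The limit process\<close>

text \<open>Eventually containing each point implies eventually containing each finite set, so no
  monotonicity of \<open>B\<close> enters.\<close>

lemma has_sum_exhaustion:
  fixes f :: "'a \<Rightarrow> real"
  assumes "(f has_sum S) A" "\<And>n. finite (B n)" "\<And>n. B n \<subseteq> A"
    and "\<And>x. x \<in> A \<Longrightarrow> \<forall>\<^sub>F n in sequentially. x \<in> B n"
  shows "(\<lambda>n. sum f (B n)) \<longlonglongrightarrow> S"
proof -
  have "filterlim B (finite_subsets_at_top A) sequentially"
    unfolding filterlim_finite_subsets_at_top
  proof (intro allI impI)
    fix X assume X: "finite X \<and> X \<subseteq> A"
    then have "\<forall>\<^sub>F n in sequentially. \<forall>x\<in>X. x \<in> B n"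
      using assms(4) by (intro eventually_ball_finite) auto
    then show "\<forall>\<^sub>F n in sequentially. finite (B n) \<and> X \<subseteq> B n \<and> B n \<subseteq> A"
      by eventually_elim (use assms(2,3) in auto)
  qed
  then show ?thesis
    using assms(1) unfolding has_sum_def by (rule filterlim_compose[rotated])
qed

lemma emeasure_point_measure_summable:
  fixes w :: "'a \<Rightarrow> real"
  assumes w: "w summable_on A" "\<And>x. x \<in> A \<Longrightarrow> 0 \<le> w x" and X: "X \<subseteq> A"
  shows "emeasure (point_measure A (\<lambda>x. ennreal (w x))) X = ennreal (infsum w X)"
proof -
  have sX: "w summable_on X" using w(1) X by (rule summable_on_subset_banach)
  have nn: "0 \<le> w x" if "x \<in> X" for x using w(2) X that by blast
  then have "(\<lambda>x. norm (w x)) summable_on X"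
    using sX by (metis (mono_tags, lifting) abs_of_nonneg real_norm_def summable_on_cong)
  then have abs: "Infinite_Set_Sum.abs_summable_on w X"
    unfolding abs_summable_equivalent .
  have "emeasure (point_measure A (\<lambda>x. ennreal (w x))) X =
      (\<integral>\<^sup>+x. ennreal (w x) * indicator X x \<partial>count_space A)"
    unfolding point_measure_def using X by (subst emeasure_density) auto
  also have "\<dots> = (\<integral>\<^sup>+x. ennreal (w x) \<partial>count_space X)"
    using X by (subst (1 2) nn_integral_count_space_indicator)
      (auto intro!: nn_integral_cong simp: indicator_def)
  also have "\<dots> = ennreal (infsetsum w X)"
    using abs nn by (rule nn_integral_conv_infsetsum)
  also have "infsetsum w X = infsum w X"
    using abs by (rule infsetsum_infsum)
  finally show ?thesis .
qed

lemma Xi_subset_half_integers: "Xi p \<subseteq> half_integers"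
proof
  fix s assume "s \<in> Xi p"
  then obtain i where "s = real (p i) - real (i + 1) + 1 / 2" by (auto simp: Xi_def)
  then have "s = real_of_int (int (p i) - int (i + 1)) + 1 / 2" by simp
  then show "s \<in> half_integers" unfolding half_integers_def by (rule range_eqI)
qed

lemma eventually_part_box:
  assumes "p \<in> partitions"
  shows "\<forall>\<^sub>F N in sequentially. p \<in> part_box N N"
proof -
  obtain n where "\<And>N M. n \<le> N \<Longrightarrow> n \<le> M \<Longrightarrow> p \<in> part_box N M"
    using partition_in_part_box[OF assms] by blast
  then show ?thesis by (intro eventually_sequentiallyI[of n]) auto
qed

context Schur_pair
begin

lemma determinantal_limit:
  assumes sum: "(W has_sum Z) partitions"
  obtains K :: "int \<Rightarrow> int \<Rightarrow> real" where
    "\<And>k n. inj_on n {..<k} \<Longrightarrow>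
      ((\<lambda>p. W p / Z) has_sum ddet k (\<lambda>a b. K (n a) (n b)))
        {p \<in> partitions. (\<lambda>a. real_of_int (n a) + 1 / 2) ` {..<k} \<subseteq> Xi p}"
proof -
  define good where "good N K \<longleftrightarrow> (\<forall>x y. \<bar>K x y\<bar> \<le> kernel_bound) \<and>
      (\<forall>k z. z ` {..<k} \<subseteq> {..<N + N} \<longrightarrow> inj_on z {..<k} \<longrightarrow>
        (\<Sum>p | p \<in> part_box N N \<and> z ` {..<k} \<subseteq> beta N p ` {..<N}. W p) =
        (\<Sum>p\<in>part_box N N. W p) * ddet k (\<lambda>a b. K (z a) (z b)))"
    for N and K :: "nat \<Rightarrow> nat \<Rightarrow> real"
  have "\<exists>K. good N K" for N
    unfolding good_def by (rule window_kernel[of N]) blast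
  then have "\<exists>KN. \<forall>N. good N (KN N)" by (intro choice allI)
  then obtain KN where "\<And>N. good N (KN N)" by blast
  then have KN: "\<And>N x y. \<bar>KN N x y\<bar> \<le> kernel_bound"
    "\<And>N k z. z ` {..<k} \<subseteq> {..<N + N} \<Longrightarrow> inj_on z {..<k} \<Longrightarrow>
      (\<Sum>p | p \<in> part_box N N \<and> z ` {..<k} \<subseteq> beta N p ` {..<N}. W p) =
      (\<Sum>p\<in>part_box N N. W p) * ddet k (\<lambda>a b. KN N (z a) (z b))"
    unfolding good_def by blast+
  \<comment> \<open>Recentring: the half-integer \<open>n + 1 / 2\<close> sits at position
    \<open>n + N\<close> of the window, so the kernels of all windows become functions of the same
    variables.\<close>
  define f where "f N = (\<lambda>(a, b). KN N (nat (a + int N)) (nat (b + int N)))" for N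
  have bound: "norm (f N x) \<le> kernel_bound" if "x \<in> UNIV" for N x
    by (cases x) (simp add: f_def KN(1))
  obtain r where r: "strict_mono (r :: nat \<Rightarrow> nat)"
    and "\<And>x. x \<in> UNIV \<Longrightarrow> \<exists>l. (\<lambda>N. f (r N) x) \<longlonglongrightarrow> l"
  proof (rule function_convergent_subsequence[OF countableI_type bound])
    fix r :: "nat \<Rightarrow> nat"
    assume "strict_mono r" "\<And>x. x \<in> UNIV \<Longrightarrow> \<exists>l. (\<lambda>N. f (r N) x) \<longlonglongrightarrow> l"
    then show thesis by (rule that)
  qed
  then have "\<exists>L. \<forall>x. (\<lambda>N. f (r N) x) \<longlonglongrightarrow> L x" by (intro choice allI) simp
  then obtain L where L: "\<And>x. (\<lambda>N. f (r N) x) \<longlonglongrightarrow> L x" by blast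
  have box: "(\<lambda>N. \<Sum>p\<in>part_box N N. W p) \<longlonglongrightarrow> Z"
    by (rule has_sum_exhaustion[OF sum]) (use part_box_subset eventually_part_box in auto)
  have "W (\<lambda>_. 0) = 1"
    using W_schur[OF empty_part_box[of 0 0]] schur_empty[of h1 0] schur_empty[of h2 0] A.h0 B.h0 by simp
  moreover have "sum W {\<lambda>_. 0} \<le> Z"
    by (rule finite_sum_le_has_sum[OF sum])
      (use W_nonneg empty_part_box[of 0 0] part_box_subset[of 0 0] in auto)
  ultimately have Z: "0 < Z" by simp
  have "((\<lambda>p. W p / Z) has_sum ddet k (\<lambda>a b. L (n a, n b)))
        {p \<in> partitions. (\<lambda>a. real_of_int (n a) + 1 / 2) ` {..<k} \<subseteq> Xi p}"
    if n: "inj_on n {..<k}" for k and n :: "nat \<Rightarrow> int"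
  proof -
    define E where "E = {p \<in> partitions. (\<lambda>a. real_of_int (n a) + 1 / 2) ` {..<k} \<subseteq> Xi p}"
    have "W summable_on E"
      by (rule summable_on_subset_banach[OF has_sum_imp_summable[OF sum]]) (auto simp: E_def)
    then obtain S where S: "(W has_sum S) E" by (auto simp: summable_on_def)
    have lim1: "(\<lambda>N. \<Sum>p | p \<in> part_box N N \<and> p \<in> E. W p) \<longlonglongrightarrow> S"
    proof (rule has_sum_exhaustion[OF S])
      show "\<forall>\<^sub>F N in sequentially. p \<in> {p \<in> part_box N N. p \<in> E}" if "p \<in> E" for p
        using eventually_part_box[of p] that by (auto simp: E_def)
    qed auto
    \<comment> \<open>From \<open>m\<close> on every requested site lies in the window
      \<open>[-N, N)\<close>, where the shift to naturals is exact and injective; the inserted 0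
      covers \<open>k = 0\<close>.\<close>
    define m where "m = Max (insert 0 ((\<lambda>a. nat \<bar>n a\<bar> + 1) ` {..<k}))"
    have m: "nat \<bar>n a\<bar> + 1 \<le> m" if "a < k" for a unfolding m_def using that by (intro Max_ge) auto
    have eq: "(\<Sum>p | p \<in> part_box N N \<and> p \<in> E. W p) = (\<Sum>p\<in>part_box N N. W p) * ddet k (\<lambda>a b. f N (n a, n b))"
      if N: "m \<le> N" for N
    proof -
      define z where "z a = nat (n a + int N)" for a
      have n': "- int N \<le> n a \<and> n a < int N" if "a < k" for a using m[OF that] N by linarith
      have zsub: "z ` {..<k} \<subseteq> {..<N + N}"
      proof (intro image_subsetI)
        fix a assume "a \<in> {..<k}"
        then show "z a \<in> {..<N + N}" using n'[of a] unfolding z_def lessThan_iff by linarith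
      qed
      have zinj: "inj_on z {..<k}"
      proof (rule inj_onI)
        fix a b assume ab: "a \<in> {..<k}" "b \<in> {..<k}" "z a = z b"
        then have "n a = n b" using n'[of a] n'[of b] by (auto simp: z_def)
        then show "a = b" using n ab by (auto simp: inj_on_def)
      qed
      have "p \<in> E \<longleftrightarrow> z ` {..<k} \<subseteq> beta N p ` {..<N}" if p: "p \<in> part_box N N" for p
        using half_integer_in_Xi[OF p] n' subsetD[OF part_box_subset p]
        by (auto simp: E_def z_def image_subset_iff)
      then have "{p. p \<in> part_box N N \<and> p \<in> E} = {p. p \<in> part_box N N \<and> z ` {..<k} \<subseteq> beta N p ` {..<N}}"
        by blast
      then show ?thesis using KN(2)[OF zsub zinj] by (simp add: f_def z_def)
    qed
    have "(\<lambda>N. (\<Sum>p\<in>part_box (r N) (r N). W p) * ddet k (\<lambda>a b. f (r N) (n a, n b)))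
        \<longlonglongrightarrow> Z * ddet k (\<lambda>a b. L (n a, n b))"
      by (intro tendsto_intros L) (use LIMSEQ_subseq_LIMSEQ[OF box r] in \<open>simp add: o_def\<close>)
    moreover have "\<forall>\<^sub>F N in sequentially. (\<Sum>p\<in>part_box (r N) (r N). W p) * ddet k (\<lambda>a b. f (r N) (n a, n b)) =
        (\<Sum>p | p \<in> part_box (r N) (r N) \<and> p \<in> E. W p)"
    proof (rule eventually_sequentiallyI[of m])
      fix N assume "m \<le> N"
      then have "m \<le> r N" using seq_suble[OF r, of N] by simp
      from eq[OF this] show "(\<Sum>p\<in>part_box (r N) (r N). W p) * ddet k (\<lambda>a b. f (r N) (n a, n b)) =
        (\<Sum>p | p \<in> part_box (r N) (r N) \<and> p \<in> E. W p)" by simp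
    qed
    ultimately have "(\<lambda>N. \<Sum>p | p \<in> part_box (r N) (r N) \<and> p \<in> E. W p) \<longlonglongrightarrow> Z * ddet k (\<lambda>a b. L (n a, n b))"
      by (rule Lim_transform_eventually)
    \<comment> \<open>The correlation sum \<open>S\<close> is known to be the limit along all
      windows, so a subsequence suffices to evaluate it.\<close>
    moreover have "(\<lambda>N. \<Sum>p | p \<in> part_box (r N) (r N) \<and> p \<in> E. W p) \<longlonglongrightarrow> S"
      using LIMSEQ_subseq_LIMSEQ[OF lim1 r] by (simp add: o_def)
    ultimately have "S = Z * ddet k (\<lambda>a b. L (n a, n b))" by (rule LIMSEQ_unique[rotated])
    then show ?thesis
      using has_sum_cmult_right[OF S, of "1 / Z"] Z by (simp add: E_def)
  qed
  then show ?thesis by (rule that[of "\<lambda>a b. L (a, b)"])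
qed

theorem Schur_process_determinantal:
  assumes sum: "(W has_sum Z) partitions"
    and w: "\<And>p. p \<in> partitions \<Longrightarrow> w p = W p / Z"
  shows "discrete_point_process (point_measure partitions (\<lambda>p. ennreal (w p))) Xi half_integers \<and>
    (\<exists>K :: real \<Rightarrow> real \<Rightarrow> complex.
      determinantal (point_measure partitions (\<lambda>p. ennreal (w p))) Xi half_integers K)"
proof -
  let ?M = "point_measure partitions (\<lambda>p. ennreal (w p))"
  obtain K :: "int \<Rightarrow> int \<Rightarrow> real" where K: "\<And>k n. inj_on n {..<k} \<Longrightarrow>
      ((\<lambda>p. W p / Z) has_sum ddet k (\<lambda>a b. K (n a) (n b)))
        {p \<in> partitions. (\<lambda>a. real_of_int (n a) + 1 / 2) ` {..<k} \<subseteq> Xi p}"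
    using determinantal_limit[OF sum] by blast
  have K': "(w has_sum ddet k (\<lambda>a b. K (n a) (n b)))
        {p \<in> partitions. (\<lambda>a. real_of_int (n a) + 1 / 2) ` {..<k} \<subseteq> Xi p}"
    if "inj_on n {..<k}" for n k
    using K[OF that] by (rule has_sum_cong[THEN iffD1, rotated]) (simp add: w)
  \<comment> \<open>The case \<open>k = 0\<close>: the empty determinant is 1, so the correlation
    formula already contains the normalisation.\<close>
  have w1: "(w has_sum 1) partitions"
    using K'[of "\<lambda>_. 0" 0] ddet_identity[of 0] by (simp add: ddet_Leibniz)
  have "0 \<le> Z" by (rule has_sum_nonneg[OF sum W_nonneg])
  then have w0: "0 \<le> w p" if "p \<in> partitions" for p
    using that W_nonneg by (simp add: w)
  have em: "emeasure ?M X = ennreal (infsum w X)" if "X \<subseteq> partitions" for X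
    using w1 w0 that by (intro emeasure_point_measure_summable) (auto simp: summable_on_def)
  have "prob_space ?M"
    using em[of partitions] w1 by (intro prob_spaceI) (simp add: space_point_measure infsumI)
  then have dpp: "discrete_point_process ?M Xi half_integers"
    using Xi_subset_half_integers
    by (auto simp: discrete_point_process_def space_point_measure sets_point_measure)
  \<comment> \<open>The floor of \<open>n + 1 / 2\<close> is \<open>n\<close>, which transports the
    kernel from integers to half-integers.\<close>
  have "determinantal ?M Xi half_integers (\<lambda>x y. complex_of_real (K \<lfloor>x\<rfloor> \<lfloor>y\<rfloor>))"
    unfolding determinantal_def
  proof (intro allI impI)
    fix k :: nat and z :: "nat \<Rightarrow> real"
    assume z: "z ` {..<k} \<subseteq> half_integers" "inj_on z {..<k}"
    have za: "z a = real_of_int \<lfloor>z a\<rfloor> + 1 / 2" if a: "a < k" for a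
    proof -
      obtain i :: int where "z a = of_int i + 1 / 2" using z(1) a by (force simp: half_integers_def)
      moreover from this have "\<lfloor>z a\<rfloor> = i" by linarith
      ultimately show ?thesis by simp
    qed
    have inj: "inj_on (\<lambda>a. \<lfloor>z a\<rfloor>) {..<k}"
    proof (rule inj_onI)
      fix a b assume "a \<in> {..<k}" "b \<in> {..<k}" "\<lfloor>z a\<rfloor> = \<lfloor>z b\<rfloor>"
      then show "a = b" using za[of a] za[of b] z(2) by (auto simp: inj_on_def)
    qed
    have "z ` {..<k} = (\<lambda>a. real_of_int \<lfloor>z a\<rfloor> + 1 / 2) ` {..<k}"
      using za by (intro image_cong) auto
    then have hs: "(w has_sum ddet k (\<lambda>a b. K \<lfloor>z a\<rfloor> \<lfloor>z b\<rfloor>)) {p \<in> partitions. z ` {..<k} \<subseteq> Xi p}"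
      using K'[OF inj] by simp
    have "0 \<le> ddet k (\<lambda>a b. K \<lfloor>z a\<rfloor> \<lfloor>z b\<rfloor>)"
      by (rule has_sum_nonneg[OF hs]) (simp add: w0)
    then have "measure ?M {p \<in> space ?M. z ` {..<k} \<subseteq> Xi p} = ddet k (\<lambda>a b. K \<lfloor>z a\<rfloor> \<lfloor>z b\<rfloor>)"
      using em[of "{p \<in> partitions. z ` {..<k} \<subseteq> Xi p}"] infsumI[OF hs]
      by (simp add: measure_def space_point_measure)
    then have "complex_of_real (measure ?M {p \<in> space ?M. z ` {..<k} \<subseteq> Xi p}) =
        Determinant.det (map_mat complex_of_real (Matrix.mat k k (\<lambda>(a, b). K \<lfloor>z a\<rfloor> \<lfloor>z b\<rfloor>)))"
      by (simp add: ddet_def of_real_hom.hom_det)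
    also have "map_mat complex_of_real (Matrix.mat k k (\<lambda>(a, b). K \<lfloor>z a\<rfloor> \<lfloor>z b\<rfloor>)) =
        Matrix.mat k k (\<lambda>(i, j). complex_of_real (K \<lfloor>z i\<rfloor> \<lfloor>z j\<rfloor>))"
      by (intro eq_matI) auto
    finally show "complex_of_real (measure ?M {p \<in> space ?M. z ` {..<k} \<subseteq> Xi p}) =
        Determinant.det (Matrix.mat k k (\<lambda>(i, j). complex_of_real (K \<lfloor>z i\<rfloor> \<lfloor>z j\<rfloor>)))" .
  qed
  then show ?thesis using dpp by blast
qed

end

section \<open>The two q-Plancherel measures\<close>

text \<open>As formal series, \<open>H (q x) = (1 - x) * H x\<close> and
  \<open>G x = (1 - x) * G (q x)\<close>. So \<open>G * H\<close> is invariant under replacing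
  \<open>x\<close> by \<open>q x\<close>, which kills every coefficient of positive degree.\<close>

lemma q_exponential_inverse:
  assumes q: "0 < q" "q < (1::real)"
  shows "(\<Sum>m\<le>n. (-1) ^ m * q ^ (\<Sum>i<m. i) / qfac q m * (1 / qfac q (n - m))) = (if n = 0 then 1 else 0)"
proof -
  define H where "H = Abs_fps (\<lambda>n. 1 / qfac q n)"
  define G where "G = Abs_fps (\<lambda>n. (-1) ^ n * q ^ (\<Sum>i<n. i) / qfac q n)"
  define Hq where "Hq = Abs_fps (\<lambda>n. q ^ n * fps_nth H n)"
  define Gq where "Gq = Abs_fps (\<lambda>n. q ^ n * fps_nth G n)"
  have nz: "qfac q n \<noteq> 0" "1 - q ^ Suc n \<noteq> 0" for n
    using qfac_pos[OF q, of n] power_Suc_less_one[of q n] q by auto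
  have "Hq = (1 - fps_X) * H"
  proof (rule fps_ext)
    show "fps_nth Hq n = fps_nth ((1 - fps_X) * H) n" for n
      using nz by (cases n) (simp_all add: Hq_def H_def left_diff_distrib fps_X_mult_nth qfac_Suc field_simps)
  qed
  moreover have "G = (1 - fps_X) * Gq"
  proof (rule fps_ext)
    show "fps_nth G n = fps_nth ((1 - fps_X) * Gq) n" for n
      using nz by (cases n) (simp_all add: Gq_def G_def left_diff_distrib fps_X_mult_nth qfac_Suc power_add field_simps)
  qed
  ultimately have "G * H = Gq * Hq" by (simp add: mult_ac)
  then have "fps_nth (G * H) n = fps_nth (Gq * Hq) n" by simp
  also have "\<dots> = q ^ n * fps_nth (G * H) n"
    unfolding fps_mult_nth sum_distrib_left Gq_def Hq_def
    by (intro sum.cong) (auto simp: power_add[symmetric] mult_ac power_add)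
  finally have "(1 - q ^ n) * fps_nth (G * H) n = 0" by (simp add: algebra_simps)
  moreover have "fps_nth (G * H) n =
      (\<Sum>m\<le>n. (-1) ^ m * q ^ (\<Sum>i<m. i) / qfac q m * (1 / qfac q (n - m)))"
    by (simp add: fps_mult_nth G_def H_def atLeast0AtMost)
  ultimately show ?thesis using nz by (cases n) auto
qed

lemma Toeplitz_inverse_q:
  assumes q: "0 < q" "q < (1::real)" and t: "0 \<le> t" "t < 1"
    and C: "1 \<le> C" "\<And>n. 1 / qfac q n \<le> C"
  shows "Toeplitz_inverse (\<lambda>n. t ^ n / qfac q n)
    (\<lambda>n. (-1) ^ n * q ^ (\<Sum>i<n. i) / qfac q n * t ^ n) C t"
proof
  fix n
  have "(\<Sum>m\<le>n. (-1) ^ m * q ^ (\<Sum>i<m. i) / qfac q m * t ^ m * (t ^ (n - m) / qfac q (n - m))) =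
      (\<Sum>m\<le>n. (-1) ^ m * q ^ (\<Sum>i<m. i) / qfac q m * (1 / qfac q (n - m)) * t ^ n)"
    by (intro sum.cong refl) (simp add: power_add[symmetric])
  also have "\<dots> = (if n = 0 then 1 else 0)"
    unfolding sum_distrib_right[symmetric] q_exponential_inverse[OF q] by simp
  finally show "(\<Sum>m\<le>n. (-1) ^ m * q ^ (\<Sum>i<m. i) / qfac q m * t ^ m * (t ^ (n - m) / qfac q (n - m))) =
      (if n = 0 then 1 else 0)" .
  have qf: "0 < qfac q n" by (rule qfac_pos[OF q])
  then have b: "t ^ n / qfac q n \<le> C * t ^ n"
    using mult_right_mono[OF C(2)[of n], of "t ^ n"] t by simp
  then show "\<bar>t ^ n / qfac q n\<bar> \<le> C * t ^ n" using qf t by (simp add: abs_mult)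
  have "q ^ (\<Sum>i<n. i) * (t ^ n / qfac q n) \<le> 1 * (t ^ n / qfac q n)"
    using q qf t by (intro mult_right_mono power_le_one) auto
  then show "\<bar>(-1) ^ n * q ^ (\<Sum>i<n. i) / qfac q n * t ^ n\<bar> \<le> C * t ^ n"
    using b qf q t by (simp add: abs_mult)
qed (use t C in auto)

text \<open>The coefficients of \<open>exp (t x) * exp (- t x) = 1\<close>. \<open>C\<close> is kept
  general because both halves of a \<open>Schur_pair\<close> share one constant.\<close>

lemma Toeplitz_inverse_exp:
  assumes t: "0 \<le> t" "t < (1::real)" and C: "1 \<le> C"
  shows "Toeplitz_inverse (\<lambda>n. t ^ n / fact n) (\<lambda>n. (- t) ^ n / fact n) C t"
proof
  fix n
  have "(\<Sum>m\<le>n. (- t) ^ m / fact m * (t ^ (n - m) / fact (n - m))) =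
      (\<Sum>m\<le>n. of_nat (n choose m) * (- t) ^ m * t ^ (n - m)) / fact n"
    unfolding sum_divide_distrib by (intro sum.cong) (auto simp: binomial_fact)
  also have "\<dots> = (- t + t) ^ n / fact n" by (simp only: binomial_ring)
  finally show "(\<Sum>m\<le>n. (- t) ^ m / fact m * (t ^ (n - m) / fact (n - m))) = (if n = 0 then 1 else 0)"
    by (simp add: power_0_left)
  have "t ^ n / fact n \<le> t ^ n / 1" using t by (intro divide_left_mono) auto
  also have "\<dots> \<le> C * t ^ n" using t C mult_right_mono[of 1 C "t ^ n"] by simp
  finally show "\<bar>t ^ n / fact n\<bar> \<le> C * t ^ n" "\<bar>(- t) ^ n / fact n\<bar> \<le> C * t ^ n"
    using t by (auto simp: abs_mult power_abs)
qed (use t C in auto)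

lemma qPP_S_determinantal:
  assumes q: "0 < q" "q < (1::real)" and xi: "0 \<le> \<xi>" "\<xi> < (1::real)"
  shows "discrete_point_process (qPP_S \<xi> q) Xi half_integers \<and>
    (\<exists>K :: real \<Rightarrow> real \<Rightarrow> complex. determinantal (qPP_S \<xi> q) Xi half_integers K)"
proof -
  define W where "W p = (\<xi>\<^sup>2 * q) ^ part_size p * q ^ (2 * part_b p) *
     (\<Prod>(i, j)\<in>cells p. 1 / (1 - q ^ hook p i j)\<^sup>2)" for p
  \<comment> \<open>The scalar \<open>\<xi>\<^sup>2 * q\<close> of the weight is split evenly, so
    that both sequences decay at the same rate below 1.\<close>
  define t where "t = \<xi> * sqrt q"
  have t: "0 \<le> t" "t < 1"
    using q xi mult_strict_mono'[of \<xi> 1 "sqrt q" 1] by (auto simp: t_def)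
  have t2: "t\<^sup>2 = \<xi>\<^sup>2 * q" using q by (simp add: t_def power_mult_distrib)
  have t2': "t\<^sup>2 < 1" "0 \<le> t\<^sup>2" using t by (auto simp: abs_square_less_1)
  obtain C where C: "1 \<le> C" "\<And>n. 1 / qfac q n \<le> C"
    using inverse_qfac_bound[OF q] by blast
  have sq: "(\<Prod>(i, j)\<in>cells p. 1 / (1 - q ^ hook p i j)) * (\<Prod>(i, j)\<in>cells p. 1 / (1 - q ^ hook p i j)) =
      (\<Prod>(i, j)\<in>cells p. 1 / (1 - q ^ hook p i j)\<^sup>2)" for p
    unfolding prod.distrib[symmetric] by (intro prod.cong) (auto simp: power2_eq_square)
  \<comment> \<open>By homogeneity only \<open>a * b\<close> matters. The split
    \<open>a = b = t\<close> serves the kernel bounds; \<open>a = 1\<close>,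
    \<open>b = t\<^sup>2\<close> serves the normalisation, where one factor has to be the unscaled
    q-specialisation.\<close>
  have JT: "W p = schur (\<lambda>n. a ^ n / qfac q n) N p * schur (\<lambda>n. b ^ n / qfac q n) N p"
    if "p \<in> part_box N M" "a * b = t\<^sup>2" for a b p N M
    unfolding schur_q[OF q that(1)] W_def sq[symmetric] t2[symmetric] that(2)[symmetric]
      mult_2 power_add power_mult_distrib
    by (simp only: mult_ac)
  have W0: "0 \<le> W p" for p
    unfolding W_def using q by (intro mult_nonneg_nonneg prod_nonneg) auto
  interpret Schur_pair "\<lambda>n. t ^ n / qfac q n" "\<lambda>n. (-1) ^ n * q ^ (\<Sum>i<n. i) / qfac q n * t ^ n"
    "\<lambda>n. t ^ n / qfac q n" "\<lambda>n. (-1) ^ n * q ^ (\<Sum>i<n. i) / qfac q n * t ^ n" C t W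
    using Toeplitz_inverse_q[OF q t C] W0 JT[of _ _ _ t t]
    by (auto simp: Schur_pair_def Schur_pair_axioms_def power2_eq_square)
  have "(W has_sum MacMahon \<xi> q) partitions"
  proof (rule Schur_weight_has_sum[OF q, where h = "\<lambda>n. (t\<^sup>2) ^ n / qfac q n"])
    have "\<bar>(t\<^sup>2) ^ n / qfac q n\<bar> = (t\<^sup>2) ^ n / qfac q n" for n
      using qfac_pos[OF q, of n] by (intro abs_of_nonneg) simp
    then show "summable (\<lambda>n. \<bar>(t\<^sup>2) ^ n / qfac q n\<bar>)"
      using summable_q_exponential[OF q, of "t\<^sup>2"] t2' by (simp only:)
    have "(\<Sum>n. (t\<^sup>2) ^ n / qfac q n * (q ^ j) ^ n) = qexp q (\<xi>\<^sup>2 * q * q ^ j)" for j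
      unfolding qexp_def t2[symmetric] power_mult_distrib by (simp add: mult_ac)
    then show "(\<lambda>N. \<Prod>j<N. \<Sum>n. (t\<^sup>2) ^ n / qfac q n * (q ^ j) ^ n) \<longlonglongrightarrow> MacMahon \<xi> q"
      using MacMahon_tendsto(1)[OF q xi] by simp
    show "W p = schur (\<lambda>n. 1 / qfac q n) N p * schur (\<lambda>n. (t\<^sup>2) ^ n / qfac q n) N p"
      if "p \<in> part_box N M" for N M p
      using JT[OF that, of 1 "t\<^sup>2"] by simp
  qed (rule W0)
  moreover have "qPP_S_weight \<xi> q p = W p / MacMahon \<xi> q" for p
    by (simp add: qPP_S_weight_def W_def)
  ultimately show ?thesis
    unfolding qPP_S_def by (intro Schur_process_determinantal) auto
qed

lemma qPP_M_determinantal: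
  assumes q: "0 < q" "q < (1::real)" and xi: "0 \<le> \<xi>" "\<xi> < (1::real)"
  shows "discrete_point_process (qPP_M \<xi> q) Xi half_integers \<and>
    (\<exists>K :: real \<Rightarrow> real \<Rightarrow> complex. determinantal (qPP_M \<xi> q) Xi half_integers K)"
proof -
  define W where "W p = \<xi> ^ (2 * part_size p) * q ^ part_b p *
     (\<Prod>(i, j)\<in>cells p. 1 / (real (hook p i j) * (1 - q ^ hook p i j)))" for p
  obtain C where C: "1 \<le> C" "\<And>n. 1 / qfac q n \<le> C"
    using inverse_qfac_bound[OF q] by blast
  have mix: "(\<Prod>(i, j)\<in>cells p. 1 / (1 - q ^ hook p i j)) * (\<Prod>(i, j)\<in>cells p. 1 / real (hook p i j)) =
      (\<Prod>(i, j)\<in>cells p. 1 / (real (hook p i j) * (1 - q ^ hook p i j)))" for p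
    unfolding prod.distrib[symmetric] by (intro prod.cong) auto
  have JT: "W p = schur (\<lambda>n. a ^ n / qfac q n) N p * schur (\<lambda>n. b ^ n / fact n) N p"
    if "p \<in> part_box N M" "a * b = \<xi>\<^sup>2" for a b p N M
    unfolding schur_q[OF q that(1)] schur_nat[OF that(1)] W_def mix[symmetric] power_mult that(2)[symmetric]
    by (simp add: power_mult_distrib mult_ac)
  have W0: "0 \<le> W p" for p
    unfolding W_def using q xi by (intro mult_nonneg_nonneg prod_nonneg) (auto simp: power_le_one)
  interpret Schur_pair "\<lambda>n. \<xi> ^ n / qfac q n" "\<lambda>n. (-1) ^ n * q ^ (\<Sum>i<n. i) / qfac q n * \<xi> ^ n"
    "\<lambda>n. \<xi> ^ n / fact n" "\<lambda>n. (- \<xi>) ^ n / fact n" C \<xi> W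
    using Toeplitz_inverse_q[OF q xi C] Toeplitz_inverse_exp[OF xi C(1)] W0 JT[of _ _ _ \<xi> \<xi>]
    by (auto simp: Schur_pair_def Schur_pair_axioms_def power2_eq_square)
  have "(W has_sum exp (\<xi>\<^sup>2 / (1 - q))) partitions"
  proof (rule Schur_weight_has_sum[OF q, where h = "\<lambda>n. (\<xi>\<^sup>2) ^ n / fact n"])
    show "summable (\<lambda>n. \<bar>(\<xi>\<^sup>2) ^ n / fact n\<bar>)"
      using summable_exp[of "\<xi>\<^sup>2"] by (simp add: divide_inverse mult.commute)
    \<comment> \<open>The exponents \<open>\<xi>\<^sup>2 * q ^ j\<close> form a geometric series in
      \<open>j\<close>, which gives the constant \<open>\<xi>\<^sup>2 / (1 - q)\<close>.\<close>
    have "(\<Sum>n. (\<xi>\<^sup>2) ^ n / fact n * (q ^ j) ^ n) = exp (\<xi>\<^sup>2 * q ^ j)" for j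
      unfolding exp_def power_mult_distrib by (simp add: divide_inverse mult_ac)
    then have eq: "(\<Prod>j<N. \<Sum>n. (\<xi>\<^sup>2) ^ n / fact n * (q ^ j) ^ n) = exp (\<xi>\<^sup>2 * (\<Sum>j<N. q ^ j))" for N
      by (simp add: exp_sum sum_distrib_left)
    have "(\<lambda>N. \<Sum>j<N. q ^ j) \<longlonglongrightarrow> 1 / (1 - q)"
      using geometric_sums[of q] q by (simp add: sums_def)
    then have "(\<lambda>N. exp (\<xi>\<^sup>2 * (\<Sum>j<N. q ^ j))) \<longlonglongrightarrow> exp (\<xi>\<^sup>2 * (1 / (1 - q)))"
      by (intro tendsto_intros)
    then show "(\<lambda>N. \<Prod>j<N. \<Sum>n. (\<xi>\<^sup>2) ^ n / fact n * (q ^ j) ^ n) \<longlonglongrightarrow> exp (\<xi>\<^sup>2 / (1 - q))"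
      unfolding eq by simp
    show "W p = schur (\<lambda>n. 1 / qfac q n) N p * schur (\<lambda>n. (\<xi>\<^sup>2) ^ n / fact n) N p"
      if "p \<in> part_box N M" for N M p
      using JT[OF that, of 1 "\<xi>\<^sup>2"] by simp
  qed (rule W0)
  moreover have "qPP_M_weight \<xi> q p = W p / exp (\<xi>\<^sup>2 / (1 - q))" for p
    by (simp add: qPP_M_weight_def W_def exp_minus divide_inverse mult_ac)
  ultimately show ?thesis
    unfolding qPP_M_def by (intro Schur_process_determinantal) auto
qed

theorem corollary2p5:
  fixes q \<xi> :: real
  assumes "0 < q" "q < 1" "0 \<le> \<xi>" "\<xi> < 1"
  shows "(discrete_point_process (qPP_S \<xi> q) Xi half_integers \<and>
          (\<exists>K :: real \<Rightarrow> real \<Rightarrow> complex. determinantal (qPP_S \<xi> q) Xi half_integers K)) \<and>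
         (discrete_point_process (qPP_M \<xi> q) Xi half_integers \<and>
          (\<exists>K :: real \<Rightarrow> real \<Rightarrow> complex. determinantal (qPP_M \<xi> q) Xi half_integers K))"
  using qPP_S_determinantal[OF assms] qPP_M_determinantal[OF assms] by blast

end
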